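(* Let $G$ be a finite graph with $\gamma(G)=\gamma^{\infty}(G)$ and maximum degree $\Delta(G)\leq 3$. Then $\gamma^{\infty}(G)=\theta(G)$.
   Context: All graphs are finite, simple and undirected. A dominating set of $G=(V,E)$ is a set $D\subseteq V$ such that every vertex of $V-D$ is adjacent to a vertex of $D$; $\gamma(G)$ is the minimum size of a dominating set. Eternal domination ("one guard moves"): a defender chooses a set $D_1\subseteq V$ and places one guard on each vertex of $D_1$. Then, for $i=1,2,\ldots$ in turn, an attacker (knowing the current position) chooses a vertex $r_i\in V-D_i$, and the defender responds by moving exactly one guard to $r_i$ from an adjacent vertex $v\in D_i$, so that $D_{i+1}=(D_i-\{v\})\cup\{r_i\}$. Every $D_i$ must be a dominating set. $D_1$ is an eternal dominating set (EDS) if the defender, starting from $D_1$, can respond in this way forever to every infinite sequence of attacks. The eternal domination number $\gamma^{\infty}(G)$ is the minimum size of an EDS of $G$. The clique covering number $\theta(G)$ is the minimum number $k$ of sets in a partition $V=V_1\cup\cdots\cup V_k$ such that each induced subgraph $G[V_i]$ is complete. *)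

theory Defs
  imports "Graph_Theory.Graph_Theory" "HOL-Library.Disjoint_Sets"
begin

text \<open>
  Finite simple undirected graphs are the symmetric digraphs of locale \<^locale>\<open>graph\<close>: an edge is a
  pair of opposite arcs. Hence the degree of a vertex is its out-degree. The null graph is allowed.
\<close>

definition max_degree :: "('a, 'b) pre_digraph \<Rightarrow> nat" where
  "max_degree G = Max (insert 0 (out_degree G ` verts G))"

definition dominating_set :: "('a, 'b) pre_digraph \<Rightarrow> 'a set \<Rightarrow> bool" where
  "dominating_set G D \<longleftrightarrow> D \<subseteq> verts G \<and> (\<forall>v \<in> verts G - D. \<exists>u \<in> D. v \<rightarrow>\<^bsub>G\<^esub> u)"

definition domination_number :: "('a, 'b) pre_digraph \<Rightarrow> nat" where
  "domination_number G = (LEAST k. \<exists>D. dominating_set G D \<and> card D = k)"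

text \<open>
  A defender strategy \<open>\<sigma>\<close> maps the list of attacks made so far, the current one last, to the vertex
  whose guard moves. \<open>guards \<sigma> D r i\<close> is the position after the attacks \<open>r 0, \<dots>, r (i - 1)\<close>, starting
  from \<open>D\<close>; it does not depend on the later attacks.
\<close>

primrec guards :: "('a list \<Rightarrow> 'a) \<Rightarrow> 'a set \<Rightarrow> (nat \<Rightarrow> 'a) \<Rightarrow> nat \<Rightarrow> 'a set" where
  "guards \<sigma> D r 0 = D"
| "guards \<sigma> D r (Suc i) = (guards \<sigma> D r i - {\<sigma> (map r [0..<Suc i])}) \<union> {r i}"

text \<open>
  Only the attacks up to the current round are required to be legal, so the strategy has to answer
  every legal finite history correctly. As the strategy is deterministic, quantifying over all attack
  sequences covers attackers who choose each attack knowing the current position. If \<open>D\<close> is the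
  whole vertex set, no attack is possible and the defender wins trivially.
\<close>

definition winning_strategy ::
    "('a, 'b) pre_digraph \<Rightarrow> 'a set \<Rightarrow> ('a list \<Rightarrow> 'a) \<Rightarrow> bool" where
  "winning_strategy G D \<sigma> \<longleftrightarrow>
    (\<forall>r i. (\<forall>j \<le> i. r j \<in> verts G - guards \<sigma> D r j) \<longrightarrow>
       \<sigma> (map r [0..<Suc i]) \<in> guards \<sigma> D r i \<and>
       \<sigma> (map r [0..<Suc i]) \<rightarrow>\<^bsub>G\<^esub> r i \<and>
       dominating_set G (guards \<sigma> D r (Suc i)))"

definition eternal_dominating_set :: "('a, 'b) pre_digraph \<Rightarrow> 'a set \<Rightarrow> bool" where
  "eternal_dominating_set G D \<longleftrightarrow> dominating_set G D \<and> (\<exists>\<sigma>. winning_strategy G D \<sigma>)"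

definition eternal_domination_number :: "('a, 'b) pre_digraph \<Rightarrow> nat" where
  "eternal_domination_number G = (LEAST k. \<exists>D. eternal_dominating_set G D \<and> card D = k)"

text \<open>
  The blocks of \<^const>\<open>partition_on\<close> are nonempty, which does not affect the minimum.
\<close>

definition clique_partition :: "('a, 'b) pre_digraph \<Rightarrow> 'a set set \<Rightarrow> bool" where
  "clique_partition G P \<longleftrightarrow>
    partition_on (verts G) P \<and> (\<forall>X \<in> P. K\<^bsub>card X\<^esub> (G \<restriction> X))"

definition clique_covering_number :: "('a, 'b) pre_digraph \<Rightarrow> nat" where
  "clique_covering_number G = (LEAST k. \<exists>P. clique_partition G P \<and> card P = k)"

end

(*
  Attacking the vertices of an independent set one after another makes the guards occupy it, so
  alpha(G) <= gamma^infinity(G) = gamma(G): every maximal independent set S has exactly gamma(G)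
  elements and is itself a winning position. The private neighbours of a vertex of S form a clique,
  and a guard can only answer an attack at a vertex adjacent to all its private neighbours. Adding
  to each s in S with private neighbours the vertices adjacent to s and to all of these gives
  cliques, because Delta(G) <= 3 and closed twins have been deleted beforehand. The remaining
  ("loose") vertices can only be defended by vertices of S without private neighbours. Short
  attack sequences, and replacing three vertices of S by two that dominate too much, show that such
  defenders either share no neighbour, and then the loose neighbours of each are adjacent, or come
  in pairs whose loose neighbours split into two cliques.
*)

theory Submission
  imports Defs
begin

text \<open>Little is known about the positions that arise in play, but every independent set of
  \<open>k\<close> vertices is a position again. So a contradiction is sought after at most two
  attacks, and where these do not suffice, a few vertices of \<open>S\<close> are exchanged to give
  an independent set \<open>S2\<close> of the same size, whose private neighbours are arranged so
  that an earlier lemma applies to it. The degree bound makes this feasible: three known neighbours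
  exhaust a neighbourhood, as facts such as \<open>Nr\<close> and \<open>Ns\<close> record.
  Exchanging vertices for fewer others gives no contradiction by itself; it yields a new vertex that
  the smaller set misses, and case distinctions run over the neighbours of that vertex. A family
  \<open>F\<close> takes the place of a strategy because deleting one of two closed twins then only
  means dropping the positions that occupy it.\<close>

text \<open>
  \<open>F\<close> is a family of positions within which the defender can answer every attack. That all of them
  have the size of a minimum dominating set encodes the equality of the two domination numbers.
\<close>

locale guarded_graph =
  fixes V :: "'a set" and E :: "'a \<Rightarrow> 'a \<Rightarrow> bool" and F :: "'a set set" and k :: nat
  assumes finite_V: "finite V"
    and E_sym: "E x y \<Longrightarrow> E y x"
    and E_irrefl: "\<not> E x x"
    and E_V: "E x y \<Longrightarrow> x \<in> V"
    and deg3: "\<lbrakk>E x a; E x b; E x c; a \<noteq> b; a \<noteq> c; b \<noteq> c; E x d\<rbrakk> \<Longrightarrow> d = a \<or> d = b \<or> d = c"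
    and F_nonempty: "F \<noteq> {}"
    and F_V: "D \<in> F \<Longrightarrow> D \<subseteq> V"
    and F_card: "D \<in> F \<Longrightarrow> card D = k"
    and F_dom: "\<lbrakk>D \<in> F; v \<in> V; v \<notin> D\<rbrakk> \<Longrightarrow> \<exists>u\<in>D. E v u"
    and F_step: "\<lbrakk>D \<in> F; v \<in> V; v \<notin> D\<rbrakk> \<Longrightarrow> \<exists>u\<in>D. E v u \<and> insert v (D - {u}) \<in> F"
    and dom_min: "\<lbrakk>D \<subseteq> V; \<forall>v\<in>V - D. \<exists>u\<in>D. E v u\<rbrakk> \<Longrightarrow> k \<le> card D"
begin

section \<open>Maximal independent sets as positions\<close>

definition indep :: "'a set \<Rightarrow> bool" where
  "indep I \<longleftrightarrow> I \<subseteq> V \<and> (\<forall>x\<in>I. \<forall>y\<in>I. \<not> E x y)"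

text \<open>
  Independent members of \<open>F\<close> are exactly the maximal independent sets (see \<open>indep_mis\<close>, \<open>ex_mis\<close>).
\<close>

definition mis :: "'a set \<Rightarrow> bool" where
  "mis S \<longleftrightarrow> S \<in> F \<and> indep S"

lemma E_V2: "E x y \<Longrightarrow> y \<in> V"
  using E_sym E_V by blast

lemma E_comm: "E x y = E y x"
  using E_sym by blast

lemma finite_sub: "D \<subseteq> V \<Longrightarrow> finite D"
  using finite_V finite_subset by blast

lemma indep_in_F:
  assumes "indep I"
  shows "\<exists>D\<in>F. I \<subseteq> D"
proof -
  have "finite I" using assms finite_sub by (simp add: indep_def)
  then show ?thesis using assms
  proof (induction I)
    case empty
    then show ?case using F_nonempty by blast
  next
    case (insert x I)
    then have "indep I" by (simp add: indep_def)
    then obtain D where D: "D \<in> F" "I \<subseteq> D" using insert.IH by blast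
    show ?case
    proof (cases "x \<in> D")
      case True
      then show ?thesis using D by blast
    next
      case False
      have "x \<in> V" using insert.prems by (simp add: indep_def)
      then obtain u where "u \<in> D" "E x u" "insert x (D - {u}) \<in> F"
        using F_step D(1) False by blast
      moreover have "u \<notin> I" using insert.prems \<open>E x u\<close> by (auto simp: indep_def)
      ultimately show ?thesis using D(2) by (intro bexI[of _ "insert x (D - {u})"]) auto
    qed
  qed
qed

lemma indep_card: "indep I \<Longrightarrow> card I \<le> k"
  using indep_in_F F_card F_V finite_sub by (metis card_mono)

lemma indep_mis:
  assumes "indep I" "k \<le> card I"
  shows "mis I"
proof -
  obtain D where "D \<in> F" "I \<subseteq> D" using indep_in_F assms(1) by blast
  then have "I = D" using assms(2) F_card F_V finite_sub by (metis card_seteq)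
  then show ?thesis using \<open>D \<in> F\<close> assms(1) by (simp add: mis_def)
qed

text \<open>A largest independent superset of \<open>I\<close> dominates, since otherwise it could
  be extended; by \<open>dom_min\<close> it then has at least \<open>k\<close> elements.\<close>

lemma ex_mis:
  assumes "indep I"
  shows "\<exists>S. mis S \<and> I \<subseteq> S"
proof -
  let ?P = "\<lambda>J. indep J \<and> I \<subseteq> J"
  have "\<exists>S. ?P S \<and> (\<forall>J. ?P J \<longrightarrow> card J \<le> card S)"
    using assms indep_card by (intro ex_has_greatest_nat[where b = "Suc k"]) (auto simp: le_imp_less_Suc)
  then obtain S where S: "indep S" "I \<subseteq> S" and max: "\<And>J. ?P J \<Longrightarrow> card J \<le> card S"
    by blast
  have finS: "finite S" using S(1) finite_sub by (simp add: indep_def)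
  have "\<exists>u\<in>S. E v u" if "v \<in> V - S" for v
  proof (rule ccontr)
    assume "\<not> (\<exists>u\<in>S. E v u)"
    then have "?P (insert v S)"
      using that S E_irrefl E_comm by (auto simp: indep_def)
    then have "card (insert v S) \<le> card S" by (rule max)
    then show False using finS that by simp
  qed
  then have "k \<le> card S" using dom_min S(1) by (simp add: indep_def)
  then show ?thesis using indep_mis S by blast
qed

lemma mis_V: "mis S \<Longrightarrow> x \<in> S \<Longrightarrow> x \<in> V"
  by (auto simp: mis_def indep_def)

lemma mis_E: "mis S \<Longrightarrow> x \<in> S \<Longrightarrow> y \<in> S \<Longrightarrow> \<not> E x y"
  by (auto simp: mis_def indep_def)

lemma mis_finite: "mis S \<Longrightarrow> finite S"
  by (auto simp: mis_def indep_def intro: finite_sub)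

lemma mis_card: "mis S \<Longrightarrow> card S = k"
  by (simp add: mis_def F_card)

lemma mis_dom: "\<lbrakk>mis S; v \<in> V; v \<notin> S\<rbrakk> \<Longrightarrow> \<exists>u\<in>S. E v u"
  by (simp add: mis_def F_dom)

section \<open>Exchanging vertices of a maximal independent set\<close>

lemma card_replace:
  assumes "mis S" "A \<subseteq> S" "finite B" "B \<inter> (S - A) = {}"
  shows "card (S - A \<union> B) + card A = k + card B"
proof -
  have "finite S" using mis_finite assms(1) by blast
  then have "card (S - A) + card A = k"
    using assms(2) mis_card[OF assms(1)] card_mono[of S A]
    by (simp add: card_Diff_subset finite_subset)
  moreover have "card (S - A \<union> B) = card (S - A) + card B"
    using \<open>finite S\<close> assms(3,4) by (intro card_Un_disjoint) auto
  ultimately show ?thesis by simp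
qed

lemma indep_replace:
  assumes "mis S" "indep B" "\<And>b x. \<lbrakk>b \<in> B; x \<in> S; E b x\<rbrakk> \<Longrightarrow> x \<in> A"
  shows "indep (S - A \<union> B)"
  using assms by (auto simp: indep_def mis_def dest: E_sym)

lemma swap_le:
  assumes "mis S" "A \<subseteq> S" "indep B" "\<And>b x. \<lbrakk>b \<in> B; x \<in> S; E b x\<rbrakk> \<Longrightarrow> x \<in> A"
    and "B \<inter> (S - A) = {}"
  shows "card B \<le> card A"
proof -
  have "card (S - A \<union> B) \<le> k"
    using indep_replace[of S B A] indep_card assms by blast
  then show ?thesis
    using card_replace[of S A B] assms finite_sub by (fastforce simp: indep_def)
qed

lemma swap_mis:
  assumes "mis S" "A \<subseteq> S" "indep B" "\<And>b x. \<lbrakk>b \<in> B; x \<in> S; E b x\<rbrakk> \<Longrightarrow> x \<in> A"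
    and "B \<inter> (S - A) = {}" "card A = card B"
  shows "mis (S - A \<union> B)"
proof (rule indep_mis)
  show "indep (S - A \<union> B)" using indep_replace[of S B A] assms by blast
  show "k \<le> card (S - A \<union> B)"
    using card_replace[of S A B] assms finite_sub by (fastforce simp: indep_def)
qed

text \<open>With fewer than \<open>k\<close> vertices the exchanged set cannot dominate. This is the
  source of the additional vertices \<open>t\<close>, \<open>w\<close> and \<open>v\<close> in the
  lemmas below.\<close>

lemma undominated:
  assumes "mis S" "A \<subseteq> S" "B \<subseteq> V" "card B < card A"
  shows "\<exists>v\<in>V. v \<notin> S - A \<and> v \<notin> B \<and> (\<forall>x\<in>S. E v x \<longrightarrow> x \<in> A) \<and> (\<forall>b\<in>B. \<not> E v b)"
proof (rule ccontr)
  assume neg: "\<not> ?thesis"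
  let ?D = "S - A \<union> B"
  have "\<exists>u\<in>?D. E v u" if "v \<in> V - ?D" for v
    using that neg by blast
  moreover have "?D \<subseteq> V" using assms(1,3) by (auto simp: mis_def indep_def)
  ultimately have "k \<le> card ?D" using dom_min by blast
  also have "\<dots> \<le> card (S - A) + card B" by (rule card_Un_le)
  also have "\<dots> < card (S - A) + card A" using assms(4) by simp
  also have "\<dots> = card S"
    using mis_finite[OF assms(1)] assms(2)
    by (simp add: card_Diff_subset card_mono finite_subset)
  finally show False using mis_card[OF assms(1)] by simp
qed

section \<open>Private neighbours and loose vertices\<close>

text \<open>The external private neighbours of \<open>s\<close>: as \<open>E\<close> is irreflexive,
  \<open>s\<close> itself is not counted, so an isolated \<open>s\<close> has none.\<close>

definition pn :: "'a set \<Rightarrow> 'a \<Rightarrow> 'a set" where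
  "pn S s = {v. E v s \<and> (\<forall>x\<in>S. E v x \<longrightarrow> x = s)}"

lemma pn_E: "v \<in> pn S s \<Longrightarrow> E v s"
  by (simp add: pn_def)

lemma pn_unique: "\<lbrakk>v \<in> pn S s; x \<in> S; E v x\<rbrakk> \<Longrightarrow> x = s"
  by (simp add: pn_def)

lemma pnI: "\<lbrakk>E v s; \<And>x. \<lbrakk>x \<in> S; E v x\<rbrakk> \<Longrightarrow> x = s\<rbrakk> \<Longrightarrow> v \<in> pn S s"
  by (auto simp: pn_def)

lemma pn_V: "v \<in> pn S s \<Longrightarrow> v \<in> V"
  by (simp add: pn_E[THEN E_V])

lemma pn_notin: "\<lbrakk>mis S; v \<in> pn S s; s \<in> S\<rbrakk> \<Longrightarrow> v \<notin> S"
  using mis_E pn_E by blast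

text \<open>Two nonadjacent private neighbours could replace \<open>s\<close>, giving an independent
  set of \<open>k + 1\<close> vertices.\<close>

lemma pn_clique:
  assumes "mis S" "s \<in> S" "u \<in> pn S s" "w \<in> pn S s" "u \<noteq> w"
  shows "E u w"
proof (rule ccontr)
  assume "\<not> E u w"
  then have "indep {u, w}"
    using assms(3,4) E_irrefl E_sym pn_V by (auto simp: indep_def)
  moreover have "u \<notin> S" "w \<notin> S"
    using assms pn_notin by blast+
  ultimately have "card {u, w} \<le> card {s}"
    using assms(1-4) pn_unique by (intro swap_le[of S]) blast+
  then show False using assms(5) by simp
qed

text \<open>A private neighbour of \<open>s\<close> other than \<open>r\<close> loses its only
  guard, so \<open>r\<close> has to dominate it.\<close>

lemma defend:
  assumes "mis S" "r \<in> V" "r \<notin> S"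
  shows "\<exists>s\<in>S. E r s \<and> insert r (S - {s}) \<in> F \<and> (\<forall>p\<in>pn S s. p = r \<or> E p r)"
proof -
  obtain s where s: "s \<in> S" "E r s" "insert r (S - {s}) \<in> F"
    using F_step assms by (auto simp: mis_def)
  have "p = r \<or> E p r" if "p \<in> pn S s" for p
  proof -
    have "p \<in> V" "p \<notin> S" using that s pn_V pn_notin assms(1) by blast+
    then obtain u where "u \<in> insert r (S - {s})" "E p u" if "p \<noteq> r"
      using F_dom[OF s(3), of p] by blast
    then show ?thesis using pn_unique[OF that] by blast
  qed
  then show ?thesis using s by blast
qed

text \<open>
  A vertex outside \<open>S\<close> is loose if it extends no clique consisting of a vertex of \<open>S\<close> and its
  nonempty set of private neighbours; in particular it has at least two neighbours in \<open>S\<close>.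
\<close>

definition loose :: "'a set \<Rightarrow> 'a \<Rightarrow> bool" where
  "loose S r \<longleftrightarrow> r \<in> V \<and> r \<notin> S \<and>
    (\<forall>s\<in>S. E r s \<longrightarrow> pn S s = {} \<or> (\<exists>p\<in>pn S s. p \<noteq> r \<and> \<not> E r p))"

lemma loose_two:
  assumes "r \<in> V" "r \<notin> S" "\<And>x. \<lbrakk>x \<in> S; E r x\<rbrakk> \<Longrightarrow> x = a \<or> x = b"
    and "p \<in> pn S a" "p \<noteq> r" "\<not> E r p" "pn S b = {}"
  shows "loose S r"
  using assms unfolding loose_def by metis

lemma loose_defend:
  assumes "mis S" "loose S r"
  shows "\<exists>s\<in>S. E r s \<and> pn S s = {} \<and> insert r (S - {s}) \<in> F"
proof -
  obtain s where "s \<in> S" "E r s" "insert r (S - {s}) \<in> F" "\<forall>p\<in>pn S s. p = r \<or> E p r"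
    using defend assms unfolding loose_def by blast
  then show ?thesis using assms(2) E_sym unfolding loose_def by blast
qed

section \<open>Common neighbours of two vertices without private neighbours\<close>

text \<open>Put \<open>r\<close> in place of \<open>s\<close> and \<open>s'\<close>. A vertex missed
  by this smaller set has all its neighbours in \<open>S\<close> among \<open>s\<close> and
  \<open>s'\<close>; being private to neither, it is adjacent to both.\<close>

lemma private_pair:
  assumes S: "mis S" and s: "s \<in> S" "s' \<in> S" "s \<noteq> s'" "pn S s = {}" "pn S s' = {}"
    and r: "E r s" "E r s'"
  shows "\<exists>t. t \<noteq> r \<and> \<not> E t r \<and> E t s \<and> E t s' \<and> (\<forall>x\<in>S. E t x \<longrightarrow> x = s \<or> x = s')"
proof -
  have "\<exists>v\<in>V. v \<notin> S - {s, s'} \<and> v \<notin> {r} \<and> (\<forall>x\<in>S. E v x \<longrightarrow> x \<in> {s, s'}) \<and> (\<forall>b\<in>{r}. \<not> E v b)"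
    by (rule undominated) (use S s r E_V in auto)
  then obtain t where t: "t \<in> V" "t \<notin> S - {s, s'}" "t \<noteq> r" "\<And>x. x \<in> S \<Longrightarrow> E t x \<Longrightarrow> x = s \<or> x = s'" "\<not> E t r"
    by auto
  have "t \<notin> S" using t r E_sym by blast
  then obtain x where "x \<in> S" "E t x" using mis_dom S t(1) by blast
  have "t \<notin> pn S s" "t \<notin> pn S s'" using s by auto
  then have "E t s \<and> E t s'"
    using t(4) \<open>x \<in> S\<close> \<open>E t x\<close> unfolding pn_def by auto
  then show ?thesis using t by blast
qed

text \<open>
  If \<open>r\<close> had a third neighbour \<open>x\<close> in \<open>S\<close>, two further common neighbours \<open>t\<close>, \<open>t'\<close> of \<open>s\<close> and \<open>s'\<close> would
  exhaust the neighbourhood of \<open>s\<close>; after attacks at \<open>r\<close> and \<open>t\<close>, neither guard is left for \<open>t'\<close>.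
\<close>

lemma shared_pair:
  assumes S: "mis S" and s: "s \<in> S" "s' \<in> S" "s \<noteq> s'" "pn S s = {}" "pn S s' = {}"
    and r: "E r s" "E r s'" and x: "x \<in> S" "E r x"
  shows "x = s \<or> x = s'"
proof (rule ccontr)
  assume x': "\<not> (x = s \<or> x = s')"
  have Nr: "z = s \<or> z = s' \<or> z = x" if "E r z" for z
    using deg3[of r s s' x z] that r x x' s(3) by metis
  have rS: "r \<in> V" "r \<notin> S" using r s mis_E[OF S] E_V by blast+
  obtain t where t: "t \<noteq> r" "\<not> E t r" "E t s" "E t s'" "\<And>z. z \<in> S \<Longrightarrow> E t z \<Longrightarrow> z = s \<or> z = s'"
    using private_pair[OF S s r] by blast
  obtain t' where t': "t' \<noteq> t" "\<not> E t' t" "E t' s" "E t' s'"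
      "\<And>z. z \<in> S \<Longrightarrow> E t' z \<Longrightarrow> z = s \<or> z = s'"
    using private_pair[OF S s t(3,4)] by blast
  have ne: "t' \<noteq> r" using t'(5) x x' by blast
  have tV: "t \<in> V" "t \<notin> S" "t' \<in> V" "t' \<notin> S"
    using t t' s mis_E[OF S] E_V by blast+
  have Ns: "z = r \<or> z = t \<or> z = t'" if "E s z" for z
    using deg3[of s r t t' z] that r t t' ne E_sym by metis
  have "pn S x = {}"
  proof (rule ccontr)
    assume "pn S x \<noteq> {}"
    then obtain p where p: "p \<in> pn S x" by blast
    have pS: "p \<notin> S" "p \<noteq> r" using p x r s x' mis_E[OF S] unfolding pn_def by blast+
    then have "\<not> E p r" using Nr[of p] x s E_sym by blast
    then obtain y where y: "y \<in> S" "E r y" "insert r (S - {y}) \<in> F" "y \<noteq> x"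
      using defend[OF S rS] p pS(2) by blast
    then have y': "y = s \<or> y = s'" using Nr by blast
    define D where "D = insert r (S - {y})"
    have D: "D \<in> F" using y D_def by simp
    obtain z where z: "z \<in> D" "E t z" "insert t (D - {z}) \<in> F"
      using F_step[OF D, of t] tV t(1) D_def by blast
    then have z': "z \<noteq> y" "z = s \<or> z = s'" using t(2,5) y(1) unfolding D_def by blast+
    obtain w where w: "w \<in> insert t (D - {z})" "E t' w"
      using F_dom[OF z(3), of t'] tV t' ne D_def by blast
    then have "w = s \<or> w = s'" "w \<in> S" "w \<noteq> y" "w \<noteq> z"
      using t' Nr[of t'] tV x s E_sym z' unfolding D_def by blast+
    then show False using z' y' by blast
  qed
  \<comment> \<open>Now \<open>private_pair\<close> applies to \<open>s\<close> and \<open>x\<close>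
    as well and asks for a fourth neighbour of \<open>s\<close>, since \<open>t\<close> and
    \<open>t'\<close> are not adjacent to \<open>x\<close>.\<close>
  then obtain q where "q \<noteq> r" "E q s" "E q x" "\<And>z. z \<in> S \<Longrightarrow> E q z \<Longrightarrow> z = s \<or> z = x"
    using private_pair[of S s x r] S s x r x' by blast
  then show False using Ns[of q] t(5) t'(5) x x' s E_sym by metis
qed

end

section \<open>Loose vertices with a single possible defender\<close>

locale twin_free_guarded_graph = guarded_graph +
  assumes no_twins: "\<lbrakk>E x y; \<And>z. z \<noteq> x \<Longrightarrow> z \<noteq> y \<Longrightarrow> E x z = E y z\<rbrakk> \<Longrightarrow> False"
begin

text \<open>The closed neighbourhoods of \<open>x\<close> and \<open>y\<close> are both exhausted by
  \<open>x\<close>, \<open>y\<close>, \<open>a\<close> and \<open>b\<close>.\<close>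

lemma no_twins_cubic:
  assumes "E x y" "E x a" "E x b" "E y a" "E y b" "a \<noteq> b"
  shows False
proof (rule no_twins[OF assms(1)])
  fix z assume z: "z \<noteq> x" "z \<noteq> y"
  have ne: "x \<noteq> y" "a \<noteq> x" "a \<noteq> y" "b \<noteq> x" "b \<noteq> y" using assms E_irrefl by auto
  show "E x z = E y z"
    using deg3[of x y a b z] deg3[of y x a b z] assms ne z E_sym by metis
qed

text \<open>
  Attack \<open>r\<close>, which moves the guard from \<open>s\<close>, and then \<open>t\<close>: the guard coming from \<open>y\<close> leaves a private
  neighbour \<open>p\<close> that only \<open>r\<close> can dominate.
\<close>

lemma loose_pair_structure:
  assumes S: "mis S" and s: "s \<in> S" "pn S s = {}"
    and r: "E r s" "loose S r" "\<And>x. x \<in> S \<Longrightarrow> E r x \<Longrightarrow> pn S x = {} \<Longrightarrow> x = s"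
    and t: "E t s" "loose S t" "\<And>x. x \<in> S \<Longrightarrow> E t x \<Longrightarrow> pn S x = {} \<Longrightarrow> x = s"
    and rt: "r \<noteq> t" "\<not> E r t"
  shows "\<exists>y\<in>S. \<exists>p. E t y \<and> \<not> E r y \<and> y \<noteq> s \<and> pn S y = {p} \<and> E p r \<and> \<not> E p t"
proof -
  have rS: "r \<in> V" "r \<notin> S" "t \<in> V" "t \<notin> S" using r(2) t(2) by (auto simp: loose_def)
  define D where "D = insert r (S - {s})"
  have D: "D \<in> F" using loose_defend[OF S r(2)] r(3) D_def by blast
  obtain y where y: "y \<in> D" "E t y" "insert t (D - {y}) \<in> F"
    using F_step[OF D, of t] rS rt D_def by blast
  have yS: "y \<in> S" "y \<noteq> s" using y rt E_sym unfolding D_def by blast+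
  then have "pn S y \<noteq> {}" using t(3) y(2) by blast
  then obtain p where p: "p \<in> pn S y" "p \<noteq> t" "\<not> E p t"
    using t(2) yS y E_sym unfolding loose_def by blast
  have dom: "q = t \<or> E q r \<or> E q t" if "q \<in> pn S y" for q
  proof -
    have "q \<in> V" "q \<notin> S" "q \<noteq> r"
      using that r(1) yS s mis_E[OF S] E_V unfolding pn_def by blast+
    then show ?thesis using F_dom[OF y(3), of q] that unfolding D_def pn_def by blast
  qed
  have pr: "E p r" using dom p by blast
  have "r \<notin> pn S s" using s by simp
  then obtain x where x: "x \<in> S" "E r x" "x \<noteq> s" using r(1) unfolding pn_def by blast
  have pS: "p \<notin> S" using p yS mis_E[OF S] unfolding pn_def by blast
  have Nr: "z = s \<or> z = x \<or> z = p" if "E r z" for z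
    using deg3[of r s x p z] that r x pr pS s E_sym by metis
  have py: "E p y" using p unfolding pn_def by blast
  \<comment> \<open>The neighbours of \<open>r\<close> are used up by \<open>s\<close>,
    \<open>x\<close> and \<open>p\<close>, so a second private neighbour \<open>q\<close> would have
    to be adjacent to \<open>t\<close>. Then \<open>q\<close> and \<open>y\<close> would be closed
    twins with the common neighbours \<open>p\<close> and \<open>t\<close>.\<close>
  have uniq: "q = p" if q: "q \<in> pn S y" for q
  proof (rule ccontr)
    assume "q \<noteq> p"
    have qS: "q \<notin> S" "q \<noteq> t" using q yS s t mis_E[OF S] unfolding pn_def by blast+
    have "E q p" using pn_clique[OF S yS(1) q p(1)] \<open>q \<noteq> p\<close> by blast
    have "\<not> E q r" using Nr[of q] qS s x \<open>q \<noteq> p\<close> E_sym by blast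
    then have "E q t" using dom[OF q] qS by blast
    have "E q y" using q unfolding pn_def by blast
    then show False
      using no_twins_cubic[of q y p t] \<open>E q p\<close> \<open>E q t\<close> py y(2) p(2) E_sym by blast
  qed
  have "\<not> E r y"
  proof
    assume "E r y"
    then obtain q where "q \<in> pn S y" "\<not> E r q"
      using r(2) yS \<open>pn S y \<noteq> {}\<close> unfolding loose_def by blast
    then show False using uniq pr E_sym by blast
  qed
  moreover have "pn S y = {p}" using uniq p by blast
  ultimately show ?thesis using yS y(2) pr p(3) by blast
qed

lemma pn_singleton:
  assumes "mis S" "s \<in> S" "pn S s = {p}"
  shows "p \<notin> S" "E p s" "\<And>x. \<lbrakk>x \<in> S; E p x\<rbrakk> \<Longrightarrow> x = s"
proof -
  have p: "p \<in> pn S s" using assms(3) by simp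
  show "p \<notin> S" "E p s" "\<And>x. \<lbrakk>x \<in> S; E p x\<rbrakk> \<Longrightarrow> x = s"
    using pn_notin[OF assms(1) p assms(2)] pn_E[OF p] pn_unique[OF p] by blast+
qed

text \<open>
  The next three lemmas treat two nonadjacent loose neighbours \<open>r\<close>, \<open>t\<close> of \<open>s\<close>, with the vertices
  \<open>y\<close>, \<open>p\<close> and \<open>y'\<close>, \<open>p'\<close> that \<open>loose_pair_structure\<close> gives for either order of the attacks. Since \<open>r\<close> and \<open>t\<close>
  dominate all of these, minimality leaves a vertex \<open>w\<close> undominated by \<open>S - {s, y, y'} \<union> {r, t}\<close>.
\<close>

lemma loose_cross_left:
  assumes S: "mis S" and s: "s \<in> S" "y \<in> S" "y' \<in> S" "s \<noteq> y" "s \<noteq> y'" "y \<noteq> y'"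
    and pn: "pn S y = {p}" "pn S y' = {p'}"
    and r: "r \<notin> S" "E r s" "E r y'" "E r p"
    and t: "t \<notin> S" "E t s" "E t y" "E t p'"
    and rt: "r \<noteq> t" "\<not> E r t"
    and w: "w \<notin> S" "w \<noteq> r" "w \<noteq> t" "\<not> E w r" "\<not> E w t" "E w s" "E w y"
      "\<And>x. x \<in> S \<Longrightarrow> E w x \<Longrightarrow> x = s \<or> x = y \<or> x = y'"
  shows False
proof -
  have p: "p \<notin> S" "E p y" "\<And>x. x \<in> S \<Longrightarrow> E p x \<Longrightarrow> x = y"
    using pn_singleton[OF S] s pn by blast+
  have p': "p' \<notin> S" "E p' y'" "\<And>x. x \<in> S \<Longrightarrow> E p' x \<Longrightarrow> x = y'"
    using pn_singleton[OF S] s pn by blast+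
  have ne: "p \<noteq> p'" "p \<noteq> r" "p \<noteq> t" "p' \<noteq> r" "p' \<noteq> t" "w \<noteq> p" "w \<noteq> p'"
    using p p' r t rt w s E_irrefl E_sym by metis+
  have Nr: "z = s \<or> z = y' \<or> z = p" if "E r z" for z
    using deg3[of r s y' p z] that r s p by metis
  have Nt: "z = s \<or> z = y \<or> z = p'" if "E t z" for z
    using deg3[of t s y p' z] that t s p' by metis
  have Ns: "z = r \<or> z = t \<or> z = w" if "E s z" for z
    using deg3[of s r t w z] that r t w rt E_sym by metis
  have Ny: "z = t \<or> z = p \<or> z = w" if "E y z" for z
    using deg3[of y t p w z] that t w p ne E_sym by metis
  have indep: "indep {r, t, w}"
    using r t rt w E_V E_irrefl E_sym unfolding indep_def by blast
  have card3: "card {s, y, y'} = 3" "card {r, t, w} = 3"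
    using s rt w by auto
  define S2 where "S2 = S - {s, y, y'} \<union> {r, t, w}"
  have S2: "mis S2" unfolding S2_def
  proof (rule swap_mis[OF S])
    fix b x assume "b \<in> {r, t, w}" "x \<in> S" "E b x"
    then show "x \<in> {s, y, y'}" using Nr Nt w p p' by blast
  qed (use s indep card3 r t w in auto)
  have in2: "r \<in> S2" "t \<in> S2" "w \<in> S2" by (auto simp: S2_def)
  have mem2: "x \<in> S \<and> x \<noteq> s \<and> x \<noteq> y \<and> x \<noteq> y' \<or> x = r \<or> x = t \<or> x = w" if "x \<in> S2" for x
    using that by (auto simp: S2_def)
  \<comment> \<open>Otherwise \<open>p\<close> and \<open>y'\<close> would both be private
    neighbours of \<open>r\<close> in \<open>S2\<close> without being adjacent.\<close>
  have w3: "E w y' \<or> E w p"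
  proof (rule ccontr)
    assume neg: "\<not> (E w y' \<or> E w p)"
    have "p \<in> pn S2 r"
    proof (rule pnI)
      show "E p r" using r E_sym by blast
      show "x = r" if "x \<in> S2" "E p x" for x
        using mem2[OF that(1)] that(2) p neg Nt ne E_sym s by metis
    qed
    moreover have "y' \<in> pn S2 r"
    proof (rule pnI)
      show "E y' r" using r E_sym by blast
      show "x = r" if "x \<in> S2" "E y' x" for x
        using mem2[OF that(1)] that(2) p' neg Nt ne E_sym s mis_E[OF S] by metis
    qed
    ultimately have "E p y'" using pn_clique[OF S2 in2(1)] p s by blast
    then show False using p s by blast
  qed
  have Nw: "(z = s \<or> z = y \<or> z = y' \<or> z = p) \<and> (E w y' \<longrightarrow> z \<noteq> p)" if "E w z" for z
    using deg3[of w s y y' z] deg3[of w s y p z] that w3 w s p by metis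
  have p'2: "p' \<in> pn S2 t"
  proof (rule pnI)
    show "E p' t" using t E_sym by blast
    show "x = t" if "x \<in> S2" "E p' x" for x
      using mem2[OF that(1)] that(2) p' Nr Nw ne E_sym s by metis
  qed
  \<comment> \<open>Whichever of \<open>p\<close> and \<open>y'\<close> is not adjacent to
    \<open>w\<close> is private to \<open>r\<close> and prevents \<open>r\<close> from defending
    \<open>s\<close>.\<close>
  obtain q where q: "q \<in> pn S2 r" "q \<noteq> s" "\<not> E s q"
  proof (cases "E w y'")
    case True
    have "p \<in> pn S2 r"
    proof (rule pnI)
      show "E p r" using r E_sym by blast
      show "x = r" if "x \<in> S2" "E p x" for x
        using mem2[OF that(1)] that(2) p True Nw Nt ne E_sym s by metis
    qed
    then show ?thesis using that[of p] p s E_sym by blast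
  next
    case False
    have "y' \<in> pn S2 r"
    proof (rule pnI)
      show "E y' r" using r E_sym by blast
      show "x = r" if "x \<in> S2" "E y' x" for x
        using mem2[OF that(1)] that(2) p' False Nt ne E_sym s mis_E[OF S] by metis
    qed
    then show ?thesis using that[of y'] s mis_E[OF S] by blast
  qed
  have w0: "pn S2 w = {}"
  proof (rule ccontr)
    assume "pn S2 w \<noteq> {}"
    then obtain v where v: "v \<in> pn S2 w" by blast
    then have "v = s \<or> v = y \<or> v = y' \<or> v = p" using Nw pn_E E_sym by blast
    then have "E v r \<or> E v t" using r t E_sym by blast
    then show False using pn_unique[OF v] in2 w by blast
  qed
  have ls: "loose S2 s"
    unfolding loose_def
  proof (intro conjI ballI impI)
    show "s \<in> V" "s \<notin> S2" using s r t w mis_V[OF S] by (auto simp: S2_def)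
    fix x assume "x \<in> S2" "E s x"
    then have "x = r \<or> x = t \<or> x = w" using Ns by blast
    then show "pn S2 x = {} \<or> (\<exists>p\<in>pn S2 x. p \<noteq> s \<and> \<not> E s p)"
      using q w0 p'2 p' s E_sym by metis
  qed
  have ly: "loose S2 y"
    unfolding loose_def
  proof (intro conjI ballI impI)
    show "y \<in> V" "y \<notin> S2" using s r t w mis_V[OF S] by (auto simp: S2_def)
    fix x assume "x \<in> S2" "E y x"
    then have "x = t \<or> x = w" using Ny mem2 p ne by blast
    then show "pn S2 x = {} \<or> (\<exists>p\<in>pn S2 x. p \<noteq> y \<and> \<not> E y p)"
      using w0 p'2 p' s E_sym by metis
  qed
  have us: "x = w" if "x \<in> S2" "E s x" "pn S2 x = {}" for x
    using Ns[OF that(2)] that(3) q p'2 by blast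
  have uy: "x = w" if "x \<in> S2" "E y x" "pn S2 x = {}" for x
    using Ny[OF that(2)] that(1,3) mem2[of x] p'2 p ne by blast
  \<comment> \<open>With respect to \<open>S2\<close> the nonadjacent vertices \<open>s\<close> and
    \<open>y\<close> are loose and only \<open>w\<close> can defend them. The lemma then wants a
    neighbour of \<open>s\<close> outside \<open>S2\<close>, but \<open>r\<close>, \<open>t\<close>
    and \<open>w\<close> are all the neighbours of \<open>s\<close>.\<close>
  obtain Y P where P: "Y \<in> S2" "pn S2 Y = {P}" "E P s"
    using loose_pair_structure[OF S2 in2(3) w0 E_sym[OF w(6)] ls us E_sym[OF w(7)] ly uy
        s(4) mis_E[OF S s(1,2)]] by blast
  then have "P \<notin> S2" using pn_notin[OF S2] by blast
  then show False using Ns P(3) in2 E_sym by blast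
qed

lemma loose_cross_triangle:
  assumes S: "mis S" and s: "s \<in> S" "y \<in> S" "y' \<in> S" "s \<noteq> y" "s \<noteq> y'" "y \<noteq> y'"
    and pn: "pn S y = {p}" "pn S y' = {p'}"
    and r: "r \<notin> S" "E r s" "E r y'" "E r p"
    and t: "t \<notin> S" "E t s" "E t y" "E t p'"
    and rt: "r \<noteq> t" "\<not> E r t"
    and w: "w \<notin> S" "w \<noteq> r" "w \<noteq> t" "\<not> E w r" "\<not> E w t" "E w y" "E w y'" "E w p"
      "\<And>x. x \<in> S \<Longrightarrow> E w x \<Longrightarrow> x = y \<or> x = y'"
  shows False
proof -
  have p: "p \<notin> S" "E p y" "\<And>x. x \<in> S \<Longrightarrow> E p x \<Longrightarrow> x = y"
    using pn_singleton[OF S] s pn by blast+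
  have p': "p' \<notin> S" "E p' y'" "\<And>x. x \<in> S \<Longrightarrow> E p' x \<Longrightarrow> x = y'"
    using pn_singleton[OF S] s pn by blast+
  have ne: "p \<noteq> p'" "p \<noteq> r" "p \<noteq> t" "p' \<noteq> r" "p' \<noteq> t" "w \<noteq> p" "w \<noteq> p'"
    using p p' r t rt w s E_irrefl E_sym by metis+
  have Nr: "z = s \<or> z = y' \<or> z = p" if "E r z" for z
    using deg3[of r s y' p z] that r s p by metis
  have Nt: "z = s \<or> z = y \<or> z = p'" if "E t z" for z
    using deg3[of t s y p' z] that t s p' by metis
  have Ny: "z = t \<or> z = p \<or> z = w" if "E y z" for z
    using deg3[of y t p w z] that t w p ne E_sym by metis
  have Ny': "z = r \<or> z = p' \<or> z = w" if "E y' z" for z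
    using deg3[of y' r p' w z] that r w p' ne E_sym by metis
  have Np: "z = y \<or> z = r \<or> z = w" if "E p z" for z
    using deg3[of p y r w z] that r w p s ne E_sym by metis
  have Nw: "z = y \<or> z = y' \<or> z = p" if "E w z" for z
    using deg3[of w y y' p z] that w p s by metis
  have "\<not> E w p'" using Nw ne p' s by blast
  moreover from this have "\<not> E p' w" using E_sym by blast
  moreover have "w \<in> V" "p' \<in> V" using w(6) p'(2) E_V by blast+
  ultimately have indep: "indep {w, p'}"
    using E_irrefl by (simp add: indep_def)
  \<comment> \<open>This exchange makes \<open>r\<close> private to \<open>s\<close>, and both
    \<open>y\<close> and \<open>p\<close> private to \<open>w\<close>.\<close>
  define S2 where "S2 = S - {y, y'} \<union> {w, p'}"
  have S2: "mis S2" unfolding S2_def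
  proof (rule swap_mis[OF S])
    show "x \<in> {y, y'}" if "b \<in> {w, p'}" "x \<in> S" "E b x" for b x
      using that w p' by blast
  qed (use s(2,3,6) indep w(1) p'(1) ne(7) in auto)
  have in2: "w \<in> S2" "p' \<in> S2" "s \<in> S2" using s by (auto simp: S2_def)
  have mem2: "x \<in> S \<and> x \<noteq> y \<and> x \<noteq> y' \<or> x = w \<or> x = p'" if "x \<in> S2" for x
    using that by (auto simp: S2_def)
  have notin2: "y \<notin> S2" "y' \<notin> S2" "p \<notin> S2" "r \<notin> S2" "t \<notin> S2"
    using mem2 ne w(1-3) p(1) p'(1) r(1) t(1) s(2,3) by metis+
  have r2: "r \<in> pn S2 s"
    using Nr r notin2 by (intro pnI) blast+
  have y2: "y \<in> pn S2 w"
    using Ny w notin2 E_sym by (intro pnI) blast+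
  have p2: "p \<in> pn S2 w"
    using Np w notin2 E_sym by (intro pnI) blast+
  have N2t: "x = s \<or> x = p'" if "x \<in> S2" "E t x" for x
    using Nt that notin2 by blast
  have N2y': "x = w \<or> x = p'" if "x \<in> S2" "E y' x" for x
    using Ny' that notin2 by blast
  have tV: "t \<in> V" "y' \<in> V" using t E_V s mis_V[OF S] by blast+
  \<comment> \<open>An attack at \<open>t\<close> has to be answered from \<open>p'\<close>: the
    guard on \<open>s\<close> is tied down by its private neighbour \<open>r\<close>.\<close>
  have p't: "v = t \<or> E v t" if "v \<in> pn S2 p'" for v
    using defend[OF S2 tV(1) notin2(5)] N2t r2 rt that by blast
  have p'0: "pn S2 p' = {}"
  proof (rule ccontr)
    assume "pn S2 p' \<noteq> {}"
    then obtain v where v: "v \<in> pn S2 p'" by blast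
    have "v \<noteq> t" using pn_unique[OF v in2(3)] t(2) s(1) p'(1) by blast
    then have "v = s \<or> v = y \<or> v = p'" using p't[OF v] Nt E_sym by blast
    then show False using pn_E[OF v] p'(3) s E_sym E_irrefl by metis
  qed
  have rt'': "\<not> E t r" using rt(2) E_sym by blast
  have lt: "loose S2 t"
    by (rule loose_two[OF tV(1) notin2(5) N2t r2 rt(1) rt'' p'0])
  have ly: "loose S2 y'"
    by (rule loose_two[OF tV(2) notin2(2) N2y' y2 s(6) mis_E[OF S s(3,2)] p'0])
  have ut: "x = p'" if "x \<in> S2" "E t x" "pn S2 x = {}" for x
    using N2t[OF that(1,2)] that(3) r2 by blast
  have uy: "x = p'" if "x \<in> S2" "E y' x" "pn S2 x = {}" for x
    using N2y'[OF that(1,2)] that(3) y2 by blast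
  have ty': "t \<noteq> y'" "\<not> E t y'" using Nt s t(1) p'(1) by blast+
  \<comment> \<open>Only \<open>p'\<close> can defend the nonadjacent loose vertices
    \<open>t\<close> and \<open>y'\<close>. The lemma asks for another neighbour of
    \<open>y'\<close> in \<open>S2\<close> with exactly one private neighbour, but the only
    candidate \<open>w\<close> has two.\<close>
  obtain Y P where P: "Y \<in> S2" "E y' Y" "Y \<noteq> p'" "pn S2 Y = {P}"
    using loose_pair_structure[OF S2 in2(2) p'0 t(4) lt ut E_sym[OF p'(2)] ly uy ty'] by blast
  then have "Y = w" using N2y' by blast
  then have "y = p" using P(4) y2 p2 by (metis singletonD)
  then show False using s(2) p(1) by blast
qed

lemma loose_cross_apart:
  assumes S: "mis S" and s: "s \<in> S" "y \<in> S" "y' \<in> S" "s \<noteq> y" "s \<noteq> y'" "y \<noteq> y'"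
    and pn: "pn S y = {p}" "pn S y' = {p'}"
    and r: "r \<notin> S" "E r s" "E r y'" "E r p"
    and t: "t \<notin> S" "E t s" "E t y" "E t p'"
    and rt: "r \<noteq> t" "\<not> E r t"
    and w: "w \<in> V" "w \<notin> S" "w \<noteq> r" "w \<noteq> t" "\<not> E w r" "\<not> E w t" "\<not> E w p" "\<not> E w p'"
      "\<And>x. x \<in> S \<Longrightarrow> E w x \<Longrightarrow> x = y \<or> x = y'"
  shows False
proof -
  have p: "p \<notin> S" "E p y" "\<And>x. x \<in> S \<Longrightarrow> E p x \<Longrightarrow> x = y"
    using pn_singleton[OF S] s pn by blast+
  have p': "p' \<notin> S" "E p' y'" "\<And>x. x \<in> S \<Longrightarrow> E p' x \<Longrightarrow> x = y'"
    using pn_singleton[OF S] s pn by blast+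
  have ne: "p \<noteq> p'" using p p' s by blast
  have Nr: "z = s \<or> z = y' \<or> z = p" if "E r z" for z
    using deg3[of r s y' p z] that r s p by metis
  have Nt: "z = s \<or> z = y \<or> z = p'" if "E t z" for z
    using deg3[of t s y p' z] that t s p' by metis
  have indep: "indep {r, t, w}"
    using r t rt w E_V E_irrefl E_sym unfolding indep_def by blast
  have card3: "card {s, y, y'} = 3" "card {r, t, w} = 3"
    using s rt w by auto
  define S2 where "S2 = S - {s, y, y'} \<union> {r, t, w}"
  have S2: "mis S2" unfolding S2_def
  proof (rule swap_mis[OF S])
    fix b x assume "b \<in> {r, t, w}" "x \<in> S" "E b x"
    then show "x \<in> {s, y, y'}" using Nr Nt w p p' by blast
  qed (use s indep card3 r t w in auto)
  have mem2: "x \<in> S \<and> x \<noteq> s \<and> x \<noteq> y \<and> x \<noteq> y' \<or> x = r \<or> x = t \<or> x = w" if "x \<in> S2" for x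
    using that by (auto simp: S2_def)
  have p2: "p \<in> pn S2 r"
  proof (rule pnI)
    show "E p r" using r E_sym by blast
    show "x = r" if "x \<in> S2" "E p x" for x
      using mem2[OF that(1)] that(2) p w Nt ne E_sym s by metis
  qed
  have p'2: "p' \<in> pn S2 t"
  proof (rule pnI)
    show "E p' t" using t E_sym by blast
    show "x = t" if "x \<in> S2" "E p' x" for x
      using mem2[OF that(1)] that(2) p' w Nr ne E_sym s by metis
  qed
  have sV: "s \<in> V" "s \<notin> S2" using s r t w mis_V[OF S] by (auto simp: S2_def)
  \<comment> \<open>An attack at \<open>s\<close> cannot be answered: \<open>w\<close> is not
    adjacent to \<open>s\<close>, while \<open>p\<close> and \<open>p'\<close> tie down the guards
    on \<open>r\<close> and \<open>t\<close>.\<close>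
  obtain x where x: "x \<in> S2" "E s x" "\<forall>q\<in>pn S2 x. q = s \<or> E q s"
    using defend[OF S2 sV] by blast
  have "\<not> E s w" using w s E_sym by metis
  then have "x = r \<or> x = t" using mem2[OF x(1)] x(2) s mis_E[OF S] by blast
  then show False using x(3) p2 p'2 p p' s by metis
qed

text \<open>The conditions on \<open>x\<close> say that \<open>s\<close> is the only vertex of
  \<open>S\<close> that can answer an attack at \<open>r\<close> or \<open>t\<close>. The cases are
  those of the vertex \<open>w\<close> missed after the exchange, up to swapping \<open>r\<close>
  with \<open>t\<close>.\<close>

lemma loose_neighbours_adjacent:
  assumes S: "mis S" and s: "s \<in> S" "pn S s = {}"
    and r: "E r s" "loose S r" "\<And>x. x \<in> S \<Longrightarrow> E r x \<Longrightarrow> pn S x = {} \<Longrightarrow> x = s"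
    and t: "E t s" "loose S t" "\<And>x. x \<in> S \<Longrightarrow> E t x \<Longrightarrow> pn S x = {} \<Longrightarrow> x = s"
    and rt: "r \<noteq> t"
  shows "E r t"
proof (rule ccontr)
  assume rt': "\<not> E r t"
  then have tr': "\<not> E t r" using E_sym by blast
  obtain y p where y: "y \<in> S" "E t y" "\<not> E r y" "y \<noteq> s" "pn S y = {p}" "E p r" "\<not> E p t"
    using loose_pair_structure[OF S s r t rt rt'] by blast
  obtain y' p' where y': "y' \<in> S" "E r y'" "\<not> E t y'" "y' \<noteq> s" "pn S y' = {p'}" "E p' t" "\<not> E p' r"
    using loose_pair_structure[OF S s t r rt[symmetric] tr'] by blast
  have rS: "r \<notin> S" "t \<notin> S" "r \<in> V" "t \<in> V" using r(2) t(2) unfolding loose_def by blast+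
  have ny: "s \<noteq> y" "s \<noteq> y'" "y \<noteq> y'" "y' \<noteq> y" using y y' by auto
  have rp: "E r p" and tp': "E t p'" using y y' E_sym by blast+
  have card3: "card {s, y, y'} = 3" using ny by auto
  have "\<exists>v\<in>V. v \<notin> S - {s, y, y'} \<and> v \<notin> {r, t} \<and> (\<forall>x\<in>S. E v x \<longrightarrow> x \<in> {s, y, y'}) \<and>
      (\<forall>b\<in>{r, t}. \<not> E v b)"
    by (rule undominated[OF S]) (use s y y' rS card3 rt in auto)
  then obtain w where w: "w \<in> V" "w \<notin> S - {s, y, y'}" "w \<noteq> r" "w \<noteq> t" "\<not> E w r" "\<not> E w t"
    and w1: "\<And>x. x \<in> S \<Longrightarrow> E w x \<Longrightarrow> x = s \<or> x = y \<or> x = y'" by auto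
  then have w2: "\<And>x. x \<in> S \<Longrightarrow> E w x \<Longrightarrow> x = s \<or> x = y' \<or> x = y" by blast
  have wS: "w \<notin> S" using w r(1) t(1) y y' E_sym by blast
  \<comment> \<open>As \<open>w\<close> is adjacent to neither \<open>r\<close> nor
    \<open>t\<close>, it is not one of the private neighbours \<open>p\<close>, \<open>p'\<close>;
    hence it has at least two neighbours among \<open>s\<close>, \<open>y\<close> and
    \<open>y'\<close>.\<close>
  have "p \<noteq> w" "p' \<noteq> w" using w y y' by blast+
  then have "w \<notin> pn S s" "w \<notin> pn S y" "w \<notin> pn S y'" using s y y' by auto
  then have "(E w s \<and> E w y) \<or> (E w s \<and> E w y') \<or> (E w y \<and> E w y' \<and> \<not> E w s)"
    using mis_dom[OF S w(1) wS] w1 unfolding pn_def by blast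
  then consider "E w s" "E w y" | "E w s" "E w y'" | "E w y" "E w y'" "\<not> E w s" by blast
  then show False
  proof cases
    case 1
    show False
      by (rule loose_cross_left[OF S s(1) y(1) y'(1) ny(1-3) y(5) y'(5) rS(1) r(1) y'(2) rp
            rS(2) t(1) y(2) tp' rt rt' wS w(3-6) 1 w1])
  next
    case 2
    show False
      by (rule loose_cross_left[OF S s(1) y'(1) y(1) ny(2,1,4) y'(5) y(5) rS(2) t(1) y(2) tp'
            rS(1) r(1) y'(2) rp rt[symmetric] tr' wS w(4,3,6,5) 2 w2])
  next
    case 3
    then have w3: "\<And>x. x \<in> S \<Longrightarrow> E w x \<Longrightarrow> x = y \<or> x = y'" using w1 by blast
    then have w4: "\<And>x. x \<in> S \<Longrightarrow> E w x \<Longrightarrow> x = y' \<or> x = y" by blast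
    consider "E w p" | "E w p'" | "\<not> E w p" "\<not> E w p'" by blast
    then show False
    proof cases
      case 1
      show False
        by (rule loose_cross_triangle[OF S s(1) y(1) y'(1) ny(1-3) y(5) y'(5) rS(1) r(1) y'(2) rp
            rS(2) t(1) y(2) tp' rt rt' wS w(3-6) 3(1,2) 1 w3])
    next
      case 2
      show False
        by (rule loose_cross_triangle[OF S s(1) y'(1) y(1) ny(2,1,4) y'(5) y(5) rS(2) t(1) y(2) tp'
            rS(1) r(1) y'(2) rp rt[symmetric] tr' wS w(4,3,6,5) 3(2,1) 2 w4])
    next
      case 3
      show False
        by (rule loose_cross_apart[OF S s(1) y(1) y'(1) ny(1-3) y(5) y'(5) rS(1) r(1) y'(2) rp
            rS(2) t(1) y(2) tp' rt rt' w(1) wS w(3-6) 3 w3])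
    qed
  qed
qed

section \<open>Pairs of defenders that share neighbours\<close>

text \<open>
  Unless \<open>v\<close> exists, \<open>u\<close> is the only vertex that \<open>S - {s, s', y} \<union> {p, t}\<close> does not dominate.
\<close>

lemma double_pair_escape:
  assumes S: "mis S" and s: "s \<in> S" "s' \<in> S" "s \<noteq> s'" "pn S s = {}" "pn S s' = {}"
    and r: "E r s" "E r s'" "\<And>x. x \<in> S \<Longrightarrow> E r x \<Longrightarrow> x = s \<or> x = s'"
    and t: "E t s" "E t s'" "\<And>x. x \<in> S \<Longrightarrow> E t x \<Longrightarrow> x = s \<or> x = s'"
    and rt: "r \<noteq> t" "\<not> E r t"
    and u: "E u s" "\<not> E u s'" "u \<noteq> r" "u \<noteq> t" "\<not> E u r" "\<not> E u t"
    and y: "y \<in> S" "y \<noteq> s" "y \<noteq> s'" "E u y"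
    and p: "p \<in> pn S y" "p \<noteq> u" "\<not> E p u" "E p r"
  shows "\<exists>v. E v s' \<and> E v y \<and> \<not> E v s \<and> (\<forall>x\<in>S. E v x \<longrightarrow> x = s' \<or> x = y) \<and> v \<noteq> p \<and> \<not> E v p \<and> \<not> E v t"
proof (rule ccontr)
  assume neg: "\<not> ?thesis"
  have pS: "p \<notin> S" "E p y" using pn_notin[OF S p(1) y(1)] pn_E[OF p(1)] by blast+
  note pu = pn_unique[OF p(1)]
  have V: "r \<in> V" "t \<in> V" "u \<in> V" "p \<in> V" "s \<in> V" "y \<in> V"
    using r(1) t(1) u(1) s y(1) mis_V[OF S] E_V pn_V[OF p(1)] by blast+
  have notS: "r \<notin> S" "t \<notin> S" "u \<notin> S" using r t u s mis_E[OF S] by blast+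
  have ne: "p \<noteq> r" "p \<noteq> t" using p(4) rt E_irrefl E_sym by blast+
  have Ns: "z = r \<or> z = t \<or> z = u" if "E s z" for z
    using deg3[of s r t u z] that r t u rt E_sym by metis
  have Nr: "z = s \<or> z = s' \<or> z = p" if "E r z" for z
    using deg3[of r s s' p z] that r s p pS E_sym by metis
  have card3: "card {s, s', y} = 3" using s y by auto
  have "\<exists>v\<in>V. v \<notin> S - {s, s', y} \<and> v \<notin> {p, t} \<and> (\<forall>x\<in>S. E v x \<longrightarrow> x \<in> {s, s', y}) \<and>
      (\<forall>b\<in>{p, t}. \<not> E v b)"
    by (rule undominated[OF S]) (use s y V card3 ne in auto)
  then obtain v where v: "v \<in> V" "v \<notin> S - {s, s', y}" "v \<noteq> p" "v \<noteq> t" "\<not> E v p" "\<not> E v t"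
    and v1: "\<And>x. x \<in> S \<Longrightarrow> E v x \<Longrightarrow> x = s \<or> x = s' \<or> x = y" by auto
  have vS: "v \<notin> S" using v t pS E_sym by blast
  have "v \<noteq> r" using v p E_sym by blast
  \<comment> \<open>Of the neighbours \<open>r\<close>, \<open>t\<close>, \<open>u\<close> of
    \<open>s\<close> only \<open>u\<close> qualifies, as \<open>r\<close> is adjacent to
    \<open>p\<close>. If \<open>v\<close> is not adjacent to \<open>s\<close>, it is private to
    neither \<open>s'\<close> nor \<open>y\<close>, hence adjacent to both, which the assumption
    forbids.\<close>
  have "v = u"
  proof (cases "E v s")
    case True
    then show ?thesis using Ns \<open>v \<noteq> r\<close> v(4) E_sym by blast
  next
    case False
    have "v \<notin> pn S s'" using s by simp
    moreover have "v \<notin> pn S y" using pn_clique[OF S y(1) _ p(1)] v by blast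
    ultimately have "E v s'" "E v y"
      using mis_dom[OF S v(1) vS] v1 False unfolding pn_def by blast+
    then show ?thesis using neg False v v1 by blast
  qed
  then have uS: "x = s \<or> x = y" if "x \<in> S" "E u x" for x using v1 that u by blast
  show False
  proof (cases "E p t")
    case True
    have Nt: "z = s \<or> z = s' \<or> z = p" if "E t z" for z
      using deg3[of t s s' p z] that t s True pS E_sym by metis
    \<comment> \<open>Now \<open>u\<close> is private to \<open>s\<close> and \<open>y\<close> to
      \<open>p\<close>, so only \<open>s'\<close> can answer at \<open>r\<close>. A following attack
      at \<open>t\<close> must be answered from \<open>s\<close> or \<open>p\<close>, which leaves
      \<open>u\<close> or \<open>y\<close> undominated.\<close>
    define S2 where "S2 = S - {y} \<union> {p}"
    have S2: "mis S2" unfolding S2_def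
    proof (rule swap_mis[OF S])
      show "indep {p}" using V E_irrefl by (simp add: indep_def)
      show "x \<in> {y}" if "b \<in> {p}" "x \<in> S" "E b x" for b x
        using that pu by blast
    qed (use y(1) pS(1) in auto)
    have mem: "x \<in> S2 \<longleftrightarrow> x \<in> S \<and> x \<noteq> y \<or> x = p" for x
      using pS by (auto simp: S2_def)
    have r2: "r \<notin> S2" "t \<notin> S2" "u \<notin> S2" "y \<notin> S2" using mem notS ne p y pS by blast+
    have pns: "u \<in> pn S2 s"
      using u uS mem p E_sym by (intro pnI) blast+
    have pnp: "y \<in> pn S2 p"
      using pS y mem mis_E[OF S] E_sym by (intro pnI) blast+
    obtain x where x: "x \<in> S2" "E r x" "insert r (S2 - {x}) \<in> F" "\<forall>q\<in>pn S2 x. q = r \<or> E q r"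
      using defend[OF S2 V(1) r2(1)] by blast
    have "x \<noteq> s" using x(4) pns u by blast
    moreover have "\<not> E y r" "y \<noteq> r" using y(1-3) notS(1) r(3)[OF y(1)] E_sym by blast+
    then have "x \<noteq> p" using x(4) pnp by metis
    ultimately have xs: "x = s'" using Nr x(2) by blast
    obtain z where z: "z \<in> insert r (S2 - {x})" "E t z" "insert t (insert r (S2 - {x}) - {z}) \<in> F"
      using F_step[OF x(3) V(2)] r2 rt by blast
    have "z \<noteq> r" using z rt E_sym by blast
    then have z': "z = s \<or> z = p" using Nt z xs by blast
    then show False
    proof
      assume "z = s"
      obtain c where "c \<in> insert t (insert r (S2 - {x}) - {z})" "E u c"
        using F_dom[OF z(3) V(3)] r2 u by blast
      then show False using pn_unique[OF pns, of c] u \<open>z = s\<close> by blast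
    next
      assume "z = p"
      obtain c where "c \<in> insert t (insert r (S2 - {x}) - {z})" "E y c"
        using F_dom[OF z(3) V(6)] r2 y notS by blast
      then show False using pn_unique[OF pnp, of c] r(3) t(3) y E_sym \<open>z = p\<close> by blast
    qed
  next
    case False
    have indep: "indep {p, t, u}"
      using V p u False E_irrefl E_sym unfolding indep_def by blast
    have card3': "card {p, t, u} = 3" using p u ne by auto
    \<comment> \<open>Here \<open>s'\<close> becomes private to \<open>t\<close> and
      \<open>r\<close> to \<open>p\<close>. That leaves \<open>u\<close> as the only defender of the
      nonadjacent vertices \<open>s\<close> and \<open>y\<close>, contrary to
      \<open>loose_neighbours_adjacent\<close>.\<close>
    define S2 where "S2 = S - {s, s', y} \<union> {p, t, u}"
    have S2: "mis S2" unfolding S2_def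
    proof (rule swap_mis[OF S])
      show "x \<in> {s, s', y}" if "b \<in> {p, t, u}" "x \<in> S" "E b x" for b x
        using that pu t uS by blast
    qed (use s y indep card3 card3' pS notS in auto)
    have in2: "p \<in> S2" "t \<in> S2" "u \<in> S2" by (auto simp: S2_def)
    have mem2: "x \<in> S \<and> x \<noteq> s \<and> x \<noteq> s' \<and> x \<noteq> y \<or> x = p \<or> x = t \<or> x = u" if "x \<in> S2" for x
      using that by (auto simp: S2_def)
    have notin2: "s \<notin> S2" "s' \<notin> S2" "y \<notin> S2" "r \<notin> S2"
      using mem2 s y pS notS ne rt u by blast+
    have tpn: "s' \<in> pn S2 t"
    proof (rule pnI)
      show "x = t" if "x \<in> S2" "E s' x" for x
        using mem2[OF that(1)] that(2) pu u s y mis_E[OF S] E_sym by metis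
    qed (use t E_sym in blast)
    have ppn: "r \<in> pn S2 p"
      using Nr notin2 p E_sym by (intro pnI) blast+
    have N2s: "x = t \<or> x = u" if "x \<in> S2" "E s x" for x
      using Ns that notin2 by blast
    have N2y: "x = p \<or> x = u" if "x \<in> S2" "E y x" for x
      using mem2[OF that(1)] that(2) t(3) y mis_E[OF S] E_sym by metis
    have ss: "\<not> E s s'" "\<not> E s' s" "\<not> E s y" using s y mis_E[OF S] by blast+
    obtain x where x: "x \<in> S2" "E s x" "\<forall>q\<in>pn S2 x. q = s \<or> E q s"
      using defend[OF S2 V(5) notin2(1)] by blast
    have "x \<noteq> t" using x(3) tpn ss(2) s(3) by metis
    then have xu: "x = u" using N2s[OF x(1,2)] by blast
    have u0: "pn S2 u = {}"
    proof (rule ccontr)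
      assume "pn S2 u \<noteq> {}"
      then obtain q where q: "q \<in> pn S2 u" by blast
      have "q \<noteq> s" using pn_unique[OF q in2(2)] t(1) u(4) E_sym by blast
      then have "q = r \<or> q = t \<or> q = u" using x(3) q Ns E_sym unfolding xu by blast
      then show False using pn_E[OF q] u(5,6) E_sym E_irrefl by blast
    qed
    have ls: "loose S2 s"
      by (rule loose_two[OF V(5) notin2(1) N2s tpn s(3)[symmetric] ss(1) u0])
    have ry: "r \<noteq> y" "\<not> E y r" using y(1-3) notS(1) r(3)[OF y(1)] E_sym by blast+
    have ly: "loose S2 y"
      by (rule loose_two[OF V(6) notin2(3) N2y ppn ry u0])
    have us: "x = u" if "x \<in> S2" "E s x" "pn S2 x = {}" for x
      using N2s[OF that(1,2)] that(3) tpn by blast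
    have uy: "x = u" if "x \<in> S2" "E y x" "pn S2 x = {}" for x
      using N2y[OF that(1,2)] that(3) ppn by blast
    show False
      using loose_neighbours_adjacent[OF S2 in2(3) u0 E_sym[OF u(1)] ls us E_sym[OF y(4)] ly uy]
        ss y by blast
  qed
qed

text \<open>
  Applying \<open>double_pair_escape\<close> a second time, to \<open>S - {s, s'} \<union> {r, t}\<close> with the two pairs exchanged and
  \<open>p\<close> in the place of \<open>u\<close>, asks for a fourth neighbour of \<open>y\<close>.
\<close>

lemma double_pair_third_aux:
  assumes S: "mis S" and s: "s \<in> S" "s' \<in> S" "s \<noteq> s'" "pn S s = {}" "pn S s' = {}"
    and r: "E r s" "E r s'" "\<And>x. x \<in> S \<Longrightarrow> E r x \<Longrightarrow> x = s \<or> x = s'"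
    and t: "E t s" "E t s'" "\<And>x. x \<in> S \<Longrightarrow> E t x \<Longrightarrow> x = s \<or> x = s'"
    and rt: "r \<noteq> t" "\<not> E r t"
    and u: "E u s" "\<not> E u s'" "u \<noteq> r" "u \<noteq> t" "\<not> E u r" "\<not> E u t"
    and y: "y \<in> S" "y \<noteq> s" "y \<noteq> s'" "E u y"
    and p: "p \<in> pn S y" "p \<noteq> u" "\<not> E p u" "E p r"
  shows False
proof -
  have pS: "p \<notin> S" "E p y" using pn_notin[OF S p(1) y(1)] pn_E[OF p(1)] by blast+
  note pu = pn_unique[OF p(1)]
  have V: "r \<in> V" "t \<in> V" "u \<in> V" "p \<in> V" "s \<in> V" "s' \<in> V"
    using r(1) t(1) u(1) s y(1) mis_V[OF S] E_V pn_V[OF p(1)] by blast+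
  have notS: "r \<notin> S" "t \<notin> S" "u \<notin> S" using r t u s mis_E[OF S] by blast+
  have ne: "p \<noteq> r" "p \<noteq> t" using p(4) rt E_irrefl E_sym by blast+
  obtain v where v: "E v s'" "E v y" "\<not> E v s" "v \<noteq> p" "\<not> E v p" "\<not> E v t"
    and vS: "\<And>x. x \<in> S \<Longrightarrow> E v x \<Longrightarrow> x = s' \<or> x = y"
    using double_pair_escape[OF S s r t rt u y p] by blast
  have v': "v \<notin> S" "v \<noteq> r" "v \<noteq> t" "v \<noteq> u" using v y u r t mis_E[OF S] by blast+
  have Ns: "z = r \<or> z = t \<or> z = u" if "E s z" for z
    using deg3[of s r t u z] that r t u rt E_sym by metis
  have Ns': "z = r \<or> z = t \<or> z = v" if "E s' z" for z
    using deg3[of s' r t v z] that r t v v' rt E_sym by metis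
  have Ny: "z = p \<or> z = u \<or> z = v" if "E y z" for z
    using deg3[of y p u v z] that pS y p v v' E_sym by metis
  have Nr: "z = s \<or> z = s' \<or> z = p" if "E r z" for z
    using deg3[of r s s' p z] that r s p pS E_sym by metis
  define S2 where "S2 = S - {s, s'} \<union> {r, t}"
  have S2: "mis S2" unfolding S2_def
  proof (rule swap_mis[OF S])
    show "indep {r, t}" using V rt E_irrefl E_sym unfolding indep_def by blast
    show "x \<in> {s, s'}" if "b \<in> {r, t}" "x \<in> S" "E b x" for b x
      using that r t by blast
  qed (use s rt notS in auto)
  have in2: "r \<in> S2" "t \<in> S2" "y \<in> S2" using y by (auto simp: S2_def)
  have mem2: "x \<in> S \<and> x \<noteq> s \<and> x \<noteq> s' \<or> x = r \<or> x = t" if "x \<in> S2" for x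
    using that by (auto simp: S2_def)
  have notin2: "s \<notin> S2" "s' \<notin> S2" "u \<notin> S2" "v \<notin> S2" "p \<notin> S2"
    using mem2 s pS notS ne v' u by blast+
  have N2s: "x = r \<or> x = t" if "x \<in> S2" "E s x" for x
    using Ns that notin2 by blast
  have N2s': "x = r \<or> x = t" if "x \<in> S2" "E s' x" for x
    using Ns' that notin2 by blast
  have r0: "pn S2 r = {}"
  proof (rule ccontr)
    assume "pn S2 r \<noteq> {}"
    then obtain q where q: "q \<in> pn S2 r" by blast
    then have "q = s \<or> q = s' \<or> q = p" using Nr pn_E E_sym by blast
    then have "E q t \<or> E q y" using t pS E_sym by blast
    then show False using pn_unique[OF q] in2 rt y notS by blast
  qed
  have ypn: "v \<in> pn S2 y"
  proof (rule pnI[OF v(2)])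
    have "\<not> E v r" using Nr[of v] v(4) v'(1) s(1,2) E_sym by blast
    then show "x = y" if "x \<in> S2" "E v x" for x
      using mem2[OF that(1)] that(2) vS[OF _ that(2)] v(6) by blast
  qed
  have ss: "\<not> E s s'" "\<not> E s' s" "s' \<noteq> s" using s mis_E[OF S] by blast+
  show False
  \<comment> \<open>If \<open>t\<close> has a private neighbour in \<open>S2\<close>, then
    \<open>r\<close> alone can defend the nonadjacent loose vertices \<open>s\<close> and
    \<open>s'\<close>. Otherwise \<open>r\<close> and \<open>t\<close> are a pair in
    \<open>S2\<close> with the common neighbours \<open>s'\<close> and \<open>s\<close>.\<close>
  proof (cases "pn S2 t = {}")
    case False
    then obtain z where z: "z \<in> pn S2 t" by blast
    then have zt: "E z t" by (rule pn_E)
    have z': "z \<noteq> s" "z \<noteq> s'" using pn_unique[OF z in2(1)] r rt E_sym by blast+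
    have z'': "\<not> E s z" "\<not> E s' z" using zt Ns Ns' rt u v E_irrefl by blast+
    have N2: "x = t \<or> x = r" if "x \<in> S2" "E s x" for x
      using N2s[OF that] by blast
    have N2': "x = t \<or> x = r" if "x \<in> S2" "E s' x" for x
      using N2s'[OF that] by blast
    have ls: "loose S2 s"
      by (rule loose_two[OF V(5) notin2(1) N2 z z'(1) z''(1) r0])
    have ls': "loose S2 s'"
      by (rule loose_two[OF V(6) notin2(2) N2' z z'(2) z''(2) r0])
    have us: "x = r" if "x \<in> S2" "E s x" "pn S2 x = {}" for x
      using N2s[OF that(1,2)] that(3) z by blast
    have us': "x = r" if "x \<in> S2" "E s' x" "pn S2 x = {}" for x
      using N2s'[OF that(1,2)] that(3) z by blast
    show False
      using loose_neighbours_adjacent[OF S2 in2(1) r0 E_sym[OF r(1)] ls us E_sym[OF r(2)] ls' us']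
        ss by blast
  next
    case True
    have pt: "\<not> E p t"
      using shared_pair[OF S2 in2(1,2) rt(1) r0 True p(4) _ in2(3) pS(2)] y notS by blast
    have ps: "\<not> E p s" "\<not> E p s'" using pu s y by blast+
    have ps': "p \<noteq> s'" "p \<noteq> s" using pS s by blast+
    obtain v2 where "E v2 t" "E v2 y"
      using double_pair_escape[OF S2 in2(1,2) rt(1) r0 True E_sym[OF r(2)] E_sym[OF t(2)] N2s'
          E_sym[OF r(1)] E_sym[OF t(1)] N2s ss(3,2) p(4) pt ps' ps(2,1) in2(3) _ _ pS(2) ypn v(4,5,1)]
        y notS by blast
    then show False using Ny pt u v E_sym by blast
  qed
qed

text \<open>Suppose \<open>u\<close> is adjacent to neither. It is not adjacent to
  \<open>s'\<close>, or else \<open>r\<close>, \<open>t\<close>, \<open>u\<close> could replace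
  \<open>s\<close>, \<open>s'\<close>. Exchange \<open>s\<close>, \<open>s'\<close> for
  \<open>r\<close>, \<open>t\<close> and attack \<open>u\<close>: the guard leaves some
  \<open>y\<close> with a private neighbour \<open>p\<close>, which afterwards only \<open>r\<close>
  or \<open>t\<close> can dominate.\<close>

lemma double_pair_third:
  assumes S: "mis S" and s: "s \<in> S" "s' \<in> S" "s \<noteq> s'" "pn S s = {}" "pn S s' = {}"
    and r: "E r s" "E r s'" "\<And>x. x \<in> S \<Longrightarrow> E r x \<Longrightarrow> x = s \<or> x = s'"
    and t: "E t s" "E t s'" "\<And>x. x \<in> S \<Longrightarrow> E t x \<Longrightarrow> x = s \<or> x = s'"
    and rt: "r \<noteq> t" "\<not> E r t"
    and u: "E u s" "u \<noteq> r" "u \<noteq> t" "loose S u"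
  shows "E u r \<or> E u t"
proof (rule ccontr)
  assume "\<not> ?thesis"
  then have ur: "\<not> E u r" "\<not> E u t" by blast+
  have V: "r \<in> V" "t \<in> V" "u \<in> V" using r t u E_V by blast+
  have notS: "r \<notin> S" "t \<notin> S" "u \<notin> S" using r t u s mis_E[OF S] by blast+
  have us': "\<not> E u s'"
  proof
    assume "E u s'"
    have uS: "x = s \<or> x = s'" if "x \<in> S" "E u x" for x
      using shared_pair[OF S s u(1) \<open>E u s'\<close> that] .
    have "card {r, t, u} \<le> card {s, s'}"
    proof (rule swap_le[OF S])
      show "indep {r, t, u}"
        using V rt ur E_irrefl E_sym unfolding indep_def by blast
      show "x \<in> {s, s'}" if "b \<in> {r, t, u}" "x \<in> S" "E b x" for b x
        using that r t uS by blast
    qed (use s notS in auto)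
    then show False using rt u s by auto
  qed
  have Ns: "z = r \<or> z = t \<or> z = u" if "E s z" for z
    using deg3[of s r t u z] that r t u rt E_sym by metis
  define S2 where "S2 = S - {s, s'} \<union> {r, t}"
  have S2: "mis S2" unfolding S2_def
  proof (rule swap_mis[OF S])
    show "indep {r, t}" using V rt E_irrefl E_sym unfolding indep_def by blast
    show "x \<in> {s, s'}" if "b \<in> {r, t}" "x \<in> S" "E b x" for b x
      using that r t by blast
  qed (use s rt notS in auto)
  have mem2: "x \<in> S \<and> x \<noteq> s \<and> x \<noteq> s' \<or> x = r \<or> x = t" if "x \<in> S2" for x
    using that by (auto simp: S2_def)
  have "u \<notin> S2" using mem2 notS u by blast
  then obtain y where y: "y \<in> S2" "E u y" "insert u (S2 - {y}) \<in> F"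
    using F_step[of S2 u] S2 V unfolding mis_def by blast
  then have yS: "y \<in> S" "y \<noteq> s" "y \<noteq> s'" using mem2 ur by blast+
  \<comment> \<open>Otherwise \<open>s\<close> and \<open>y\<close> would have a common neighbour
    besides \<open>u\<close>, but \<open>s\<close> has only \<open>r\<close>, \<open>t\<close> and
    \<open>u\<close>.\<close>
  have "pn S y \<noteq> {}"
  proof
    assume "pn S y = {}"
    then obtain q where "q \<noteq> u" "E q s" "E q y"
      using private_pair[OF S s(1) yS(1) yS(2)[symmetric] s(4) _ u(1) y(2)] by blast
    then show False using Ns r(3) t(3) yS E_sym by blast
  qed
  then obtain p where p: "p \<in> pn S y" "p \<noteq> u" "\<not> E p u"
    using u(4) yS y(2) E_sym unfolding loose_def by blast
  have pS: "p \<notin> S" using pn_notin[OF S p(1) yS(1)] .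
  have "p \<noteq> r" "p \<noteq> t" using pn_unique[OF p(1) s(1)] r t yS by blast+
  then have "p \<notin> insert u (S2 - {y})" using mem2 pS p by blast
  then obtain z where z: "z \<in> insert u (S2 - {y})" "E p z"
    using F_dom[OF y(3) pn_V[OF p(1)]] by blast
  then have "z = r \<or> z = t" using mem2 pn_unique[OF p(1)] p by blast
  then consider "E p r" | "E p t" using z by blast
  then show False
  proof cases
    case 1
    show False
      by (rule double_pair_third_aux[OF S s r t rt u(1) us' u(2,3) ur yS y(2) p 1])
  next
    case 2
    have tr: "t \<noteq> r" "\<not> E t r" using rt E_sym by blast+
    show False
      by (rule double_pair_third_aux[OF S s t r tr u(1) us' u(3,2) ur(2,1) yS y(2) p 2])
  qed
qed

section \<open>The clique cover of a twin-free graph\<close>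

text \<open>Two nonadjacent members would be common neighbours of \<open>s\<close> and a private
  neighbour \<open>p\<close>, making \<open>s\<close> and \<open>p\<close> closed twins.\<close>

lemma nonloose_clique:
  assumes S: "mis S" and s: "s \<in> S" "pn S s \<noteq> {}"
  shows "pairwise E (insert s {r. E r s \<and> (\<forall>p\<in>pn S s. p = r \<or> E p r)})"
proof -
  have "E a b" if a: "E a s" "\<forall>p\<in>pn S s. p = a \<or> E p a"
    and b: "E b s" "\<forall>p\<in>pn S s. p = b \<or> E p b" and ab: "a \<noteq> b" for a b
  proof (rule ccontr)
    assume nE: "\<not> E a b"
    obtain p where p: "p \<in> pn S s" using s by blast
    have "E p a" "E p b" using a(2) b(2) p ab nE E_sym by metis+
    then show False
      using no_twins_cubic[of s p a b] a(1) b(1) ab pn_E[OF p] E_sym by blast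
  qed
  then show ?thesis unfolding pairwise_def using E_sym by blast
qed

text \<open>For independent \<open>S\<close> an induced 4-cycle \<open>s\<close>, \<open>r\<close>,
  \<open>s'\<close>, \<open>t\<close>: the configuration that \<open>private_pair\<close> and
  \<open>shared_pair\<close> produce.\<close>

definition double_pair :: "'a set \<Rightarrow> 'a \<Rightarrow> 'a \<Rightarrow> 'a \<Rightarrow> 'a \<Rightarrow> bool" where
  "double_pair S s s' r t \<longleftrightarrow> s \<in> S \<and> s' \<in> S \<and> s \<noteq> s' \<and> pn S s = {} \<and> pn S s' = {} \<and>
    E r s \<and> E r s' \<and> (\<forall>x\<in>S. E r x \<longrightarrow> x = s \<or> x = s') \<and>
    E t s \<and> E t s' \<and> (\<forall>x\<in>S. E t x \<longrightarrow> x = s \<or> x = s') \<and> r \<noteq> t \<and> \<not> E r t"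

lemma double_pair_swap:
  assumes "double_pair S s s' r t"
  shows "double_pair S s' s r t" "double_pair S s s' t r"
  using assms E_sym unfolding double_pair_def by blast+

lemma double_pair_loose:
  assumes S: "mis S" and d: "double_pair S s s' r t" and u: "loose S u" "E u s \<or> E u s'" "u \<noteq> r" "u \<noteq> t"
  shows "E u r \<or> E u t"
proof -
  have *: "E u r \<or> E u t" if "double_pair S a a' r t" "E u a" for a a'
    using double_pair_third[OF S, of a a' r t u] that u unfolding double_pair_def by blast
  show ?thesis using * d double_pair_swap(1)[OF d] u(2) by blast
qed

text \<open>For \<open>Y\<close> without private neighbours, this is what \<open>card Y\<close>
  cliques have to cover.\<close>

definition loose_hull :: "'a set \<Rightarrow> 'a set \<Rightarrow> 'a set" where
  "loose_hull S Y = Y \<union> {u. loose S u \<and> (\<exists>s\<in>Y. E u s)}"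

text \<open>The triangle \<open>s\<close>, \<open>r\<close>, \<open>u\<close> uses up the degrees of
  \<open>s\<close> and \<open>r\<close>. Hence every further loose vertex in question is adjacent to
  \<open>s'\<close> and, by \<open>double_pair_loose\<close>, to \<open>t\<close>; the degree of
  \<open>s'\<close> admits only one.\<close>

lemma double_pair_cover_aux:
  assumes S: "mis S" and d: "double_pair S s s' r t"
    and u: "loose S u" "u \<noteq> r" "u \<noteq> t" "E u s" "E u r"
  shows "\<exists>A B. pairwise E A \<and> pairwise E B \<and> loose_hull S {s, s'} \<subseteq> A \<union> B"
proof -
  have r: "E r s" "E r s'" "E t s" "E t s'" "r \<noteq> t" "s \<noteq> s'" "s \<in> S" "s' \<in> S"
    using d unfolding double_pair_def by blast+
  have uS: "u \<notin> S" "u \<noteq> s" "u \<noteq> s'" using u r unfolding loose_def by blast+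
  define W where "W = {x. loose S x \<and> (E x s \<or> E x s') \<and> x \<noteq> r \<and> x \<noteq> t \<and> x \<noteq> u}"
  have Ns: "z = r \<or> z = t \<or> z = u" if "E s z" for z
    using deg3[of s r t u z] that r u E_sym by metis
  have Nr: "z = s \<or> z = s' \<or> z = u" if "E r z" for z
    using deg3[of r s s' u z] that r u uS E_sym by metis
  have W: "E x s' \<and> E x t" if "x \<in> W" for x
  proof -
    have x: "loose S x" "E x s \<or> E x s'" "x \<noteq> r" "x \<noteq> t" "x \<noteq> u" using that unfolding W_def by blast+
    have "x \<noteq> s" "x \<noteq> s'" using x(1) r unfolding loose_def by blast+
    then show ?thesis
      using Ns[of x] Nr[of x] double_pair_loose[OF S d x(1-4)] x E_sym by blast
  qed
  have "x = y" if "x \<in> W" "y \<in> W" for x y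
    using deg3[of s' r t x y] W[OF that(1)] W[OF that(2)] that r E_sym unfolding W_def by blast
  then have "pairwise E ({s', t} \<union> W)"
    unfolding pairwise_def using W r E_sym by blast
  moreover have "pairwise E {s, r, u}"
    unfolding pairwise_def using r u E_sym by blast
  moreover have "loose_hull S {s, s'} \<subseteq> {s, r, u} \<union> ({s', t} \<union> W)"
    unfolding loose_hull_def W_def by blast
  ultimately show ?thesis by blast
qed

lemma double_pair_cover:
  assumes S: "mis S" and d: "double_pair S s s' r t"
  shows "\<exists>A B. pairwise E A \<and> pairwise E B \<and> loose_hull S {s, s'} \<subseteq> A \<union> B"
proof (cases "\<exists>u. loose S u \<and> (E u s \<or> E u s') \<and> u \<noteq> r \<and> u \<noteq> t")
  case False
  have r: "E r s" "E t s'" using d unfolding double_pair_def by blast+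
  have "pairwise E {s, r}" "pairwise E {s', t}"
    unfolding pairwise_def using r E_sym by blast+
  moreover have "loose_hull S {s, s'} \<subseteq> {s, r} \<union> {s', t}"
    using False unfolding loose_hull_def by blast
  ultimately show ?thesis by blast
next
  case True
  then obtain u where u: "loose S u" "E u s \<or> E u s'" "u \<noteq> r" "u \<noteq> t" by blast
  note d' = double_pair_swap[OF d]
  note d'' = double_pair_swap(2)[OF d'(1)]
  have eq: "{s', s} = {s, s'}" by blast
  have "E u r \<or> E u t" using double_pair_loose[OF S d u] .
  then consider "E u s" "E u r" | "E u s" "E u t" | "E u s'" "E u r" | "E u s'" "E u t"
    using u by blast
  then show ?thesis
  proof cases
    case 1 then show ?thesis using double_pair_cover_aux[OF S d u(1,3,4)] by blast
  next
    case 2 then show ?thesis using double_pair_cover_aux[OF S d'(2) u(1,4,3)] by blast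
  next
    case 3 then show ?thesis using double_pair_cover_aux[OF S d'(1) u(1,3,4)] eq by metis
  next
    case 4 then show ?thesis using double_pair_cover_aux[OF S d'' u(1,4,3)] eq by metis
  qed
qed

lemma ex_double_pair:
  assumes "mis S" "s \<in> S" "s' \<in> S" "s \<noteq> s'" "pn S s = {}" "pn S s' = {}" "E r s" "E r s'"
  shows "\<exists>t. double_pair S s s' r t"
proof -
  obtain t where "t \<noteq> r" "\<not> E t r" "E t s" "E t s'" "\<And>x. x \<in> S \<Longrightarrow> E t x \<Longrightarrow> x = s \<or> x = s'"
    using private_pair[OF assms] by blast
  then have "double_pair S s s' r t"
    using assms shared_pair[OF assms] E_sym unfolding double_pair_def by metis
  then show ?thesis by blast
qed

text \<open>On the vertices of \<open>S\<close> without private neighbours these sets turn out to be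
  equivalence classes of at most two elements; each class is covered as a unit.\<close>

definition partners :: "'a set \<Rightarrow> 'a \<Rightarrow> 'a set" where
  "partners S s = {s' \<in> S. pn S s' = {} \<and> (s' = s \<or> (\<exists>c. E c s \<and> E c s'))}"

text \<open>Each partner contributes two common neighbours with \<open>s\<close>. Those for
  \<open>a\<close> have no further neighbour in \<open>S\<close>, so two partners would give
  \<open>s\<close> four neighbours.\<close>

lemma partners_unique:
  assumes S: "mis S" and s: "s \<in> S" "pn S s = {}"
    and a: "a \<in> partners S s" "a \<noteq> s" and b: "b \<in> partners S s" "b \<noteq> s"
  shows "a = b"
proof (rule ccontr)
  assume ab: "a \<noteq> b"
  obtain c where c: "a \<in> S" "pn S a = {}" "E c s" "E c a" using a unfolding partners_def by blast
  obtain d where d: "b \<in> S" "pn S b = {}" "E d s" "E d b" using b unfolding partners_def by blast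
  obtain c' where c': "double_pair S s a c c'"
    using ex_double_pair[OF S s(1) c(1) a(2)[symmetric] s(2) c(2-4)] by blast
  obtain d' where d': "double_pair S s b d d'"
    using ex_double_pair[OF S s(1) d(1) b(2)[symmetric] s(2) d(2-4)] by blast
  have "E s c" "E s c'" "E s d" "E s d'" "c \<noteq> c'" "d \<noteq> d'"
    using c' d' E_sym unfolding double_pair_def by blast+
  moreover have "\<not> E c b" "\<not> E c' b" using c' d(1) ab b(2) unfolding double_pair_def by blast+
  moreover have "E d b" "E d' b" using d' unfolding double_pair_def by blast+
  ultimately show False using deg3[of s c c' d d'] by metis
qed

lemma partners_eq:
  assumes S: "mis S" and s: "s \<in> S" "pn S s = {}" and a: "a \<in> partners S s"
  shows "partners S a = partners S s"
proof (cases "a = s")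
  case False
  have a': "a \<in> S" "pn S a = {}" "s \<in> partners S a" "s \<in> partners S s" "a \<in> partners S a"
    using a s unfolding partners_def by blast+
  have "partners S s = {s, a}" using partners_unique[OF S s a False] a a' by blast
  moreover have "partners S a = {s, a}"
    using partners_unique[OF S a'(1-3) False[symmetric]] a' by blast
  ultimately show ?thesis by simp
qed simp

text \<open>Indexing the cliques by the members of the class ensures that one clique per vertex of
  \<open>S\<close> suffices in total.\<close>

lemma partners_cover:
  assumes S: "mis S" and s: "s \<in> S" "pn S s = {}"
  shows "\<exists>h. (\<forall>x\<in>partners S s. pairwise E (h x)) \<and> loose_hull S (partners S s) \<subseteq> \<Union> (h ` partners S s)"
proof (cases "\<exists>a\<in>partners S s. a \<noteq> s")
  case True
  then obtain a where a: "a \<in> partners S s" "a \<noteq> s" by blast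
  then obtain c where c: "a \<in> S" "pn S a = {}" "E c s" "E c a" unfolding partners_def by blast
  obtain t where "double_pair S s a c t"
    using ex_double_pair[OF S s(1) c(1) a(2)[symmetric] s(2) c(2-4)] by blast
  then obtain A B where AB: "pairwise E A" "pairwise E B" "loose_hull S {s, a} \<subseteq> A \<union> B"
    using double_pair_cover[OF S] by blast
  have "s \<in> partners S s" using s unfolding partners_def by blast
  then have eq: "partners S s = {s, a}" using partners_unique[OF S s a] a by blast
  have "\<Union> ((\<lambda>x. if x = s then A else B) ` partners S s) = A \<union> B"
    using a eq by auto
  then show ?thesis using AB eq by (intro exI[of _ "\<lambda>x. if x = s then A else B"]) auto
next
  case False
  moreover have "s \<in> partners S s" using s unfolding partners_def by blast
  ultimately have eq: "partners S s = {s}" by blast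
  have uniq: "x = s" if "E r s" "x \<in> S" "E r x" "pn S x = {}" for r x
  proof -
    have "x \<in> partners S s" using that unfolding partners_def by blast
    then show ?thesis using eq by blast
  qed
  have "E r t" if "E r s" "loose S r" "E t s" "loose S t" "r \<noteq> t" for r t
    using loose_neighbours_adjacent[OF S s that(1,2) uniq[OF that(1)] that(3,4) uniq[OF that(3)] that(5)] .
  then have "pairwise E (loose_hull S {s})"
    unfolding pairwise_def loose_hull_def using E_sym by blast
  then show ?thesis using eq by auto
qed

lemma clique_cover:
  "\<exists>P. finite P \<and> card P \<le> k \<and> (\<forall>K\<in>P. pairwise E K) \<and> V \<subseteq> \<Union> P"
proof -
  have "indep {}" by (simp add: indep_def)
  then obtain S where S: "mis S" using ex_mis by blast
  \<comment> \<open>The choice depends on the class only, so that two partners receive the two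
    cliques of the same cover.\<close>
  define H where "H Y = (SOME h. (\<forall>x\<in>Y. pairwise E (h x)) \<and> loose_hull S Y \<subseteq> \<Union> (h ` Y))" for Y
  have H: "(\<forall>x\<in>partners S s. pairwise E (H (partners S s) x)) \<and>
      loose_hull S (partners S s) \<subseteq> \<Union> (H (partners S s) ` partners S s)"
    if "s \<in> S" "pn S s = {}" for s
    unfolding H_def by (rule someI_ex[OF partners_cover[OF S that]])
  define C where "C s = (if pn S s = {} then H (partners S s) s
      else insert s {r. E r s \<and> (\<forall>p\<in>pn S s. p = r \<or> E p r)})" for s
  have self: "s \<in> partners S s" if "s \<in> S" "pn S s = {}" for s
    using that unfolding partners_def by blast
  have hull: "loose_hull S (partners S s) \<subseteq> \<Union> (C ` S)" if s: "s \<in> S" "pn S s = {}" for s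
  proof
    fix v assume "v \<in> loose_hull S (partners S s)"
    then obtain a where a: "a \<in> partners S s" "v \<in> H (partners S s) a" using H[OF s] by blast
    then have "a \<in> S" "pn S a = {}" unfolding partners_def by blast+
    moreover have "C a = H (partners S s) a"
      using partners_eq[OF S s a(1)] \<open>pn S a = {}\<close> unfolding C_def by simp
    ultimately show "v \<in> \<Union> (C ` S)" using a(2) by blast
  qed
  have "pairwise E (C s)" if "s \<in> S" for s
    using H[of s] self[of s] nonloose_clique[OF S, of s] that unfolding C_def by simp
  moreover have "v \<in> \<Union> (C ` S)" if v: "v \<in> V" for v
  proof (cases "v \<in> S")
    case True
    show ?thesis
    proof (cases "pn S v = {}")
      case True
      then show ?thesis using hull[of v] self[of v] \<open>v \<in> S\<close> unfolding loose_hull_def by blast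
    next
      case False
      then have "v \<in> C v" unfolding C_def by simp
      then show ?thesis using \<open>v \<in> S\<close> by blast
    qed
  next
    case False
    show ?thesis
    proof (cases "loose S v")
      case True
      then obtain s where s: "s \<in> S" "E v s" "pn S s = {}" using loose_defend[OF S] by blast
      then have "v \<in> loose_hull S (partners S s)"
        using True self[of s] unfolding loose_hull_def by blast
      then show ?thesis using hull[OF s(1,3)] by blast
    next
      case nl: False
      then obtain s where s: "s \<in> S" "E v s" "pn S s \<noteq> {}" "\<forall>p\<in>pn S s. p = v \<or> E v p"
        using v False unfolding loose_def by blast
      then have "v \<in> C s" unfolding C_def using E_sym by auto
      then show ?thesis using s(1) by blast
    qed
  qed
  ultimately show ?thesis
    using mis_finite[OF S] mis_card[OF S] card_image_le[of S C] by (intro exI[of _ "C ` S"]) auto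
qed

end

section \<open>Deletion of closed twins\<close>

text \<open>No guard enters \<open>x\<close> unless \<open>x\<close> is attacked, and a maximal
  independent set through \<open>y\<close> is a position avoiding \<open>x\<close>. A dominating set
  of the smaller graph also dominates \<open>x\<close>, because it dominates \<open>y\<close>; hence
  \<open>k\<close> stays minimal.\<close>

lemma (in guarded_graph) delete_twin:
  assumes xy: "E x y" and twin: "\<And>z. z \<noteq> x \<Longrightarrow> z \<noteq> y \<Longrightarrow> E x z = E y z"
  shows "guarded_graph (V - {x}) (\<lambda>a b. E a b \<and> a \<noteq> x \<and> b \<noteq> x) {D \<in> F. x \<notin> D} k"
proof
  have "indep {y}" using xy E_V2 E_irrefl by (simp add: indep_def)
  then obtain S where "mis S" "y \<in> S" using ex_mis by blast
  then have "S \<in> F" "x \<notin> S" using xy mis_E by (auto simp: mis_def)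
  then show "{D \<in> F. x \<notin> D} \<noteq> {}" by blast
  fix D assume D: "D \<subseteq> V - {x}" "\<forall>v\<in>V - {x} - D. \<exists>u\<in>D. E v u \<and> v \<noteq> x \<and> u \<noteq> x"
  have "\<exists>u\<in>D. E v u" if "v \<in> V - D" for v
  proof (cases "v = x")
    case True
    show ?thesis
    proof (cases "y \<in> D")
      case False
      have "y \<in> V - {x} - D" using xy False E_V2 E_irrefl by blast
      then obtain u where "u \<in> D" "E y u" "u \<noteq> x" using D(2) by blast
      then show ?thesis using twin[of u] True False by blast
    qed (use xy True in blast)
  qed (use D that in blast)
  moreover have "D \<subseteq> V" using D(1) by blast
  ultimately show "k \<le> card D" using dom_min[of D] by simp
next
  fix D v assume "D \<in> {D \<in> F. x \<notin> D}" "v \<in> V - {x}" "v \<notin> D"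
  then show "\<exists>u\<in>D. (E v u \<and> v \<noteq> x \<and> u \<noteq> x) \<and> insert v (D - {u}) \<in> {D \<in> F. x \<notin> D}"
    using F_step[of D v] by blast
next
  show "finite (V - {x})" using finite_V by simp
next
  fix a b c d z assume "E z a \<and> z \<noteq> x \<and> a \<noteq> x" "E z b \<and> z \<noteq> x \<and> b \<noteq> x" "E z c \<and> z \<noteq> x \<and> c \<noteq> x"
    "a \<noteq> b" "a \<noteq> c" "b \<noteq> c" "E z d \<and> z \<noteq> x \<and> d \<noteq> x"
  then show "d = a \<or> d = b \<or> d = c" using deg3[of z a b c d] by simp
next
  fix a b assume "E a b \<and> a \<noteq> x \<and> b \<noteq> x"
  then show "E b a \<and> b \<noteq> x \<and> a \<noteq> x" "a \<in> V - {x}" using E_sym E_V by blast+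
next
  fix a show "\<not> (E a a \<and> a \<noteq> x \<and> a \<noteq> x)" using E_irrefl by blast
next
  fix D assume D: "D \<in> {D \<in> F. x \<notin> D}"
  then show "D \<subseteq> V - {x}" "card D = k" using F_V[of D] F_card[of D] by blast+
  fix v assume "v \<in> V - {x}" "v \<notin> D"
  then show "\<exists>u\<in>D. E v u \<and> v \<noteq> x \<and> u \<noteq> x" using F_dom[of D v] D by blast
qed

theorem guarded_graph_clique_cover:
  assumes "guarded_graph V E F k"
  shows "\<exists>P. finite P \<and> card P \<le> k \<and> (\<forall>K\<in>P. pairwise E K) \<and> V \<subseteq> \<Union> P"
  using assms
proof (induction "card V" arbitrary: V E F rule: less_induct)
  case less
  interpret guarded_graph V E F k by (rule less.prems)
  show ?case
  proof (cases "\<exists>x y. E x y \<and> (\<forall>z. z \<noteq> x \<longrightarrow> z \<noteq> y \<longrightarrow> E x z = E y z)")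
    case False
    then have "twin_free_guarded_graph V E F k"
      by unfold_locales blast
    then show ?thesis by (rule twin_free_guarded_graph.clique_cover)
  next
    case True
    then obtain x y where xy: "E x y" "\<And>z. z \<noteq> x \<Longrightarrow> z \<noteq> y \<Longrightarrow> E x z = E y z" by blast
    have "card (V - {x}) < card V" using finite_V E_V[OF xy(1)] by (intro card_Diff1_less)
    from less.hyps[OF this delete_twin[OF xy]]
    obtain P where P: "finite P" "card P \<le> k" "V - {x} \<subseteq> \<Union> P"
      "\<forall>K\<in>P. pairwise (\<lambda>a b. E a b \<and> a \<noteq> x \<and> b \<noteq> x) K" by blast
    \<comment> \<open>The vertex \<open>x\<close> joins the cliques that contain its twin, so their
      number does not grow.\<close>
    define g where "g K = (if y \<in> K then insert x K else K)" for K
    have "pairwise E (g K)" if "K \<in> P" for K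
    proof -
      have K: "E a b" if "a \<in> K" "b \<in> K" "a \<noteq> b" for a b
        using P(4) \<open>K \<in> P\<close> that unfolding pairwise_def by blast
      have "E x b \<and> E b x" if "y \<in> K" "b \<in> K" "b \<noteq> x" for b
        using K[of y b] xy(1) xy(2)[of b] that E_sym by blast
      then show ?thesis unfolding g_def pairwise_def using K by auto
    qed
    moreover have "V \<subseteq> \<Union> (g ` P)"
    proof
      fix v assume "v \<in> V"
      define v' where "v' = (if v = x then y else v)"
      have "v' \<in> V - {x}" using \<open>v \<in> V\<close> xy(1) E_V2 E_irrefl by (auto simp: v'_def)
      then obtain K where "K \<in> P" "v' \<in> K" using P(3) by blast
      then have "v \<in> g K" by (auto simp: g_def v'_def split: if_splits)
      then show "v \<in> \<Union> (g ` P)" using \<open>K \<in> P\<close> by blast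
    qed
    ultimately show ?thesis
      using P(1,2) card_image_le[of P g] by (intro exI[of _ "g ` P"]) auto
  qed
qed

section \<open>Clique covers and clique partitions\<close>

text \<open>A clique contains at most one vertex of an independent set, and there is one with
  \<open>k\<close> vertices.\<close>

lemma (in guarded_graph) clique_cover_ge:
  assumes P: "finite P" "V \<subseteq> \<Union> P" "\<forall>K\<in>P. pairwise E K"
  shows "k \<le> card P"
proof -
  have "indep {}" by (simp add: indep_def)
  then obtain S where S: "mis S" using ex_mis by blast
  then have "\<forall>s\<in>S. \<exists>K\<in>P. s \<in> K" using P(2) mis_V by blast
  then obtain f where f: "\<And>s. s \<in> S \<Longrightarrow> f s \<in> P \<and> s \<in> f s" by metis
  have "inj_on f S"
    using f P(3) mis_E[OF S] unfolding inj_on_def pairwise_def by metis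
  moreover have "f ` S \<subseteq> P" using f by blast
  ultimately have "card S \<le> card P" using P(1) by (metis card_inj_on_le)
  then show ?thesis using mis_card[OF S] by simp
qed

text \<open>Every vertex selects one set of the cover containing it; the nonempty fibres of this
  choice are the blocks.\<close>

lemma ex_partition_refining_cover:
  assumes "finite P" "V \<subseteq> \<Union> P"
  shows "\<exists>Q. partition_on V Q \<and> card Q \<le> card P \<and> (\<forall>X\<in>Q. \<exists>K\<in>P. X \<subseteq> K)"
proof -
  have "\<forall>v\<in>V. \<exists>K. K \<in> P \<and> v \<in> K" using assms(2) by blast
  then obtain f where f: "\<And>v. v \<in> V \<Longrightarrow> f v \<in> P \<and> v \<in> f v"
    using bchoice[of V "\<lambda>v K. K \<in> P \<and> v \<in> K"] by blast
  define Q where "Q = (\<lambda>K. {v \<in> V. f v = K}) ` (f ` V)"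
  have fP: "finite (f ` V)" "f ` V \<subseteq> P" using f assms(1) finite_subset[of "f ` V" P] by blast+
  have "partition_on V Q"
    by (rule partition_onI) (auto simp: Q_def disjnt_def)
  moreover have "card Q \<le> card P"
    using card_image_le[OF fP(1), of "\<lambda>K. {v \<in> V. f v = K}"] card_mono[OF assms(1) fP(2)]
    unfolding Q_def by linarith
  moreover have "\<exists>K\<in>P. X \<subseteq> K" if "X \<in> Q" for X
  proof -
    obtain v where v: "v \<in> V" "X = {w \<in> V. f w = f v}" using \<open>X \<in> Q\<close> unfolding Q_def by blast
    then have "X \<subseteq> f v" using f by fastforce
    then show ?thesis using f[OF v(1)] by blast
  qed
  ultimately show ?thesis by blast
qed

lemma arcs_ends_induce_subgraph: "arcs_ends (G \<restriction> X) = arcs_ends G \<inter> X \<times> X"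
  by (auto simp: arcs_ends_def arc_to_ends_def)

lemma (in graph) complete_induce_subgraph_iff:
  assumes "X \<subseteq> verts G"
  shows "K\<^bsub>card X\<^esub> (G \<restriction> X) \<longleftrightarrow> pairwise (\<lambda>u v. u \<rightarrow>\<^bsub>G\<^esub> v) X"
proof -
  have "induced_subgraph (G \<restriction> X) G" using assms by (rule induced_induce)
  then have "sym_digraph (G \<restriction> X)" by (rule induced_graph_imp_graph)
  moreover have "digraph (G \<restriction> X)"
    using assms finite_subset[OF assms] finite_arcs no_loops no_multi_arcs
    by unfold_locales (auto simp: arc_to_ends_def)
  ultimately have "graph (G \<restriction> X)"
    by (simp add: digraph.graphI sym_digraph.sym_arcs)
  moreover have "\<not> u \<rightarrow>\<^bsub>G\<^esub> u" for u
    using no_loops by (auto simp: arcs_ends_def arc_to_ends_def)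
  ultimately show ?thesis
    unfolding complete_digraph_def arcs_ends_induce_subgraph pairwise_def by auto
qed

section \<open>From defender strategies to families of positions\<close>

text \<open>This allows the next attack to be overwritten without changing the positions reached so
  far.\<close>

lemma guards_cong:
  assumes "\<And>j. j < i \<Longrightarrow> r j = r' j"
  shows "guards \<sigma> D r i = guards \<sigma> D r' i"
  using assms
proof (induction i)
  case (Suc i)
  have "map r [0..<Suc i] = map r' [0..<Suc i]"
    using Suc.prems by (intro map_cong) auto
  then show ?case using Suc by (simp only: guards.simps)
qed simp

lemma (in graph) nbrs_le_3:
  assumes deg: "max_degree G \<le> 3"
    and nb: "x \<rightarrow>\<^bsub>G\<^esub> a" "x \<rightarrow>\<^bsub>G\<^esub> b" "x \<rightarrow>\<^bsub>G\<^esub> c" "x \<rightarrow>\<^bsub>G\<^esub> d" and ne: "a \<noteq> b" "a \<noteq> c" "b \<noteq> c"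
  shows "d = a \<or> d = b \<or> d = c"
proof (rule ccontr)
  assume "\<not> ?thesis"
  then have "card {a, b, c, d} = 4" using ne by auto
  moreover have "{a, b, c, d} \<subseteq> head G ` out_arcs G x"
    using nb by (auto simp: arcs_ends_def arc_to_ends_def)
  moreover have fin: "finite (out_arcs G x)" by (simp add: out_arcs_def)
  ultimately have "4 \<le> out_degree G x"
    unfolding out_degree_def by (metis card_image_le card_mono finite_imageI le_trans)
  moreover have "x \<in> verts G" using nb(1) by (rule adj_in_verts)
  then have "out_degree G x \<le> max_degree G"
    unfolding max_degree_def by (intro Max_ge) auto
  ultimately show False using deg by simp
qed

text \<open>\<open>F\<close> collects the positions that the strategy reaches after legal attacks. A
  legal move preserves the number of guards, so all of them are minimum dominating sets.\<close>

lemma (in graph) guarded_graph_of_eternal_dominating_set: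
  assumes deg: "max_degree G \<le> 3"
    and D: "eternal_dominating_set G D" "card D = domination_number G"
  shows "\<exists>F. guarded_graph (verts G) (\<lambda>u v. u \<rightarrow>\<^bsub>G\<^esub> v) F (domination_number G)"
proof -
  obtain \<sigma> where \<sigma>: "winning_strategy G D \<sigma>" and dom: "dominating_set G D"
    using D(1) unfolding eternal_dominating_set_def by blast
  let ?g = "guards \<sigma> D" and ?a = "\<lambda>r i. \<sigma> (map r [0..<Suc i])"
  define legal where "legal r i \<longleftrightarrow> (\<forall>j<i. r j \<in> verts G - ?g r j)" for r i
  define F where "F = {?g r i |r i. legal r i}"
  have step: "?a r i \<in> ?g r i" "?a r i \<rightarrow>\<^bsub>G\<^esub> r i" "dominating_set G (?g r (Suc i))"
    if "legal r (Suc i)" for r i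
    using \<sigma> that unfolding winning_strategy_def legal_def less_Suc_eq_le by blast+
  have legal_Suc: "legal r i" "r i \<notin> ?g r i" if "legal r (Suc i)" for r i
    using that unfolding legal_def by auto
  have dom: "dominating_set G (?g r i)" if "legal r i" for r i
    using that dom step(3) by (cases i) simp_all
  have fin: "finite (?g r i)" if "legal r i" for r i
    using dom[OF that] finite_subset[OF _ finite_verts] unfolding dominating_set_def by blast
  have card: "card (?g r i) = domination_number G" if "legal r i" for r i
    using that
  proof (induction i)
    case 0
    then show ?case using D(2) by simp
  next
    case (Suc i)
    note l = legal_Suc[OF Suc.prems]
    have "card (?g r (Suc i)) = Suc (card (?g r i - {?a r i}))"
      using fin[OF l(1)] l(2) by simp
    also have "\<dots> = card (?g r i)"
      using fin[OF l(1)] step(1)[OF Suc.prems] by (rule card_Suc_Diff1)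
    finally show ?case using Suc.IH[OF l(1)] by simp
  qed
  have "guarded_graph (verts G) (\<lambda>u v. u \<rightarrow>\<^bsub>G\<^esub> v) F (domination_number G)"
  proof
    show "finite (verts G)" by simp
    show "F \<noteq> {}" unfolding F_def legal_def by blast
  next
    fix x y assume "x \<rightarrow>\<^bsub>G\<^esub> y"
    then show "y \<rightarrow>\<^bsub>G\<^esub> x" "x \<in> verts G" by (auto simp: graph_symmetric)
  next
    fix x show "\<not> x \<rightarrow>\<^bsub>G\<^esub> x" using no_loops by (auto simp: arcs_ends_def arc_to_ends_def)
  next
    fix x a b c d assume "x \<rightarrow>\<^bsub>G\<^esub> a" "x \<rightarrow>\<^bsub>G\<^esub> b" "x \<rightarrow>\<^bsub>G\<^esub> c" "a \<noteq> b" "a \<noteq> c" "b \<noteq> c" "x \<rightarrow>\<^bsub>G\<^esub> d"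
    then show "d = a \<or> d = b \<or> d = c" using nbrs_le_3[OF deg] by blast
  next
    fix C assume "C \<in> F"
    then obtain r i where C: "C = ?g r i" "legal r i" unfolding F_def by blast
    show "C \<subseteq> verts G" using dom[OF C(2)] C(1) unfolding dominating_set_def by simp
    show "card C = domination_number G" using card C by simp
    fix v assume v: "v \<in> verts G" "v \<notin> C"
    then show "\<exists>u\<in>C. v \<rightarrow>\<^bsub>G\<^esub> u" using dom[OF C(2)] C(1) unfolding dominating_set_def by simp
    \<comment> \<open>Only the entries of \<open>r\<close> before \<open>i\<close> led to
      \<open>C\<close>, so entry \<open>i\<close> is free to become \<open>v\<close>; later entries
      do not matter.\<close>
    define r' where "r' = r(i := v)"
    have r': "?g r' j = ?g r j" if "j \<le> i" for j
      using that by (intro guards_cong) (simp add: r'_def)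
    have l: "legal r' (Suc i)"
      unfolding legal_def
    proof (intro allI impI)
      fix j assume "j < Suc i"
      then show "r' j \<in> verts G - ?g r' j"
        using r'[of j] C v unfolding legal_def r'_def by (cases "j = i") auto
    qed
    have "?g r' (Suc i) = insert v (C - {?a r' i})"
      using r'[of i] C(1) by (simp add: r'_def)
    then have "insert v (C - {?a r' i}) \<in> F" using l unfolding F_def by blast
    moreover have "?a r' i \<in> C" using step(1)[OF l] r'[of i] C(1) by simp
    moreover have "v \<rightarrow>\<^bsub>G\<^esub> ?a r' i"
      using step(2)[OF l] by (simp add: r'_def graph_symmetric)
    ultimately show "\<exists>u\<in>C. v \<rightarrow>\<^bsub>G\<^esub> u \<and> insert v (C - {u}) \<in> F" by blast
  next
    fix C assume "C \<subseteq> verts G" "\<forall>v\<in>verts G - C. \<exists>u\<in>C. v \<rightarrow>\<^bsub>G\<^esub> u"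
    then have "dominating_set G C" unfolding dominating_set_def by blast
    then show "domination_number G \<le> card C"
      unfolding domination_number_def by (intro Least_le) blast
  qed
  then show ?thesis by blast
qed

text \<open>The full vertex set is eternally dominating, so the \<open>LEAST\<close> in the
  definition is attained.\<close>

lemma ex_minimum_eternal_dominating_set:
  "\<exists>D. eternal_dominating_set G D \<and> card D = eternal_domination_number G"
proof -
  have "winning_strategy G (verts G) \<sigma>" for \<sigma>
    unfolding winning_strategy_def by (metis Diff_cancel empty_iff guards.simps(1) zero_le)
  then have "eternal_dominating_set G (verts G)"
    unfolding eternal_dominating_set_def dominating_set_def by blast
  then show ?thesis
    unfolding eternal_domination_number_def
    by (intro LeastI[where P = "\<lambda>k. \<exists>D. eternal_dominating_set G D \<and> card D = k"]) blast
qed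

theorem theorem6p3:
  fixes G :: "('a, 'b) pre_digraph"
  assumes "graph G"
    and "domination_number G = eternal_domination_number G"
    and "max_degree G \<le> 3"
  shows "eternal_domination_number G = clique_covering_number G"
proof -
  interpret graph G by (rule assms(1))
  define k where "k = domination_number G"
  obtain F where F: "guarded_graph (verts G) (\<lambda>u v. u \<rightarrow>\<^bsub>G\<^esub> v) F k"
    using ex_minimum_eternal_dominating_set[of G] assms(2,3)
      guarded_graph_of_eternal_dominating_set unfolding k_def by metis
  have lower: "k \<le> card P" if "clique_partition G P" for P
  proof -
    have P: "partition_on (verts G) P" "\<forall>X\<in>P. K\<^bsub>card X\<^esub> (G \<restriction> X)"
      using that unfolding clique_partition_def by blast+
    have union: "\<Union> P = verts G" using P(1) by (rule partition_onD1[symmetric])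
    have "finite P" using P(1) by (rule finite_elements[OF finite_verts])
    moreover have "\<forall>X\<in>P. pairwise (\<lambda>u v. u \<rightarrow>\<^bsub>G\<^esub> v) X"
      using P(2) union complete_induce_subgraph_iff by blast
    ultimately show ?thesis using guarded_graph.clique_cover_ge[OF F] union by simp
  qed
  obtain P where P: "finite P" "card P \<le> k" "\<forall>K\<in>P. pairwise (\<lambda>u v. u \<rightarrow>\<^bsub>G\<^esub> v) K" "verts G \<subseteq> \<Union> P"
    using guarded_graph_clique_cover[OF F] by blast
  obtain Q where Q: "partition_on (verts G) Q" "card Q \<le> card P" "\<forall>X\<in>Q. \<exists>K\<in>P. X \<subseteq> K"
    using ex_partition_refining_cover[OF P(1,4)] by blast
  have "K\<^bsub>card X\<^esub> (G \<restriction> X)" if "X \<in> Q" for X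
  proof -
    have "X \<subseteq> verts G" using that partition_onD1[OF Q(1)] by blast
    moreover obtain K where "K \<in> P" "X \<subseteq> K" using Q(3) \<open>X \<in> Q\<close> by blast
    then have "pairwise (\<lambda>u v. u \<rightarrow>\<^bsub>G\<^esub> v) X"
      using P(3) pairwise_subset by blast
    ultimately show ?thesis by (simp add: complete_induce_subgraph_iff)
  qed
  then have cp: "clique_partition G Q" using Q(1) unfolding clique_partition_def by blast
  have "clique_covering_number G = k"
    unfolding clique_covering_number_def
  proof (rule Least_equality)
    show "\<exists>P. clique_partition G P \<and> card P = k"
      using cp lower[OF cp] Q(2) P(2) by (intro exI[of _ Q]) simp
  qed (use lower in blast)
  then show ?thesis using assms(2) unfolding k_def by simp
qed

end
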